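(* (In $\mathrm{ZF}$.) For all primes $p$ and all natural numbers $k$, $\mathrm{p^kRC_{fin}}$ implies $\mathrm{p^kWOC^-_{fin}}$.
   Context: The base theory is $\mathrm{ZF}$ (no Axiom of Choice). For a set $x$ and $n\in\omega$, $[x]^n$ is the set of all $n$-element subsets of $x$ and $[x]^{>n}$ is the set of all finite subsets of $x$ with more than $n$ elements. The principles below are used with $n=p^k$. $\mathrm{nRC_{fin}}$: given any infinite set $x$, there exist an infinite subset $y\subseteq x$ and a function $f\colon[y]^{>n}\to[y]^n$ such that $f(z)\subseteq z$ for all $z\in[y]^{>n}$. $\mathrm{nWOC^-_{fin}}$: given any infinite well-ordered family $\mathcal F$ of finite sets of cardinality greater than $n$, there exist an infinite subfamily $\mathcal A\subseteq\mathcal F$ and a function $f\colon\mathcal A\to[\bigcup\mathcal A]^n$ such that $f(A)\subseteq A$ for all $A\in\mathcal A$. *)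

theory Defs
  imports Main
begin

text \<open>
  HOL itself satisfies the axiom of choice, so ZF without choice is treated as a first-order theory.
  A structure for the language of set theory is a type with an arbitrary binary relation; ``provable
  in ZF'' is read as ``true in every model of ZF'' (equivalent by the completeness theorem). The
  separation and replacement schemes range over first-order formulas with parameters only: with
  arbitrary HOL predicates in their place, every model would satisfy choice.
  All set-theoretic notions, including the natural numbers, are internal to the model: the
  quantifiers in their definitions range over its elements, and its \<open>\<omega>\<close> may be nonstandard.
\<close>

datatype fm =
    Mem nat nat
  | Eql nat nat
  | Neg fm
  | Conj fm fm
  | All nat fm

locale set_structure =
  fixes mem :: "'a \<Rightarrow> 'a \<Rightarrow> bool"  (infix "\<epsilon>" 50)
begin

primrec sat :: "(nat \<Rightarrow> 'a) \<Rightarrow> fm \<Rightarrow> bool" where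
  "sat v (Mem i j) \<longleftrightarrow> v i \<epsilon> v j"
| "sat v (Eql i j) \<longleftrightarrow> v i = v j"
| "sat v (Neg \<phi>) \<longleftrightarrow> \<not> sat v \<phi>"
| "sat v (Conj \<phi> \<psi>) \<longleftrightarrow> sat v \<phi> \<and> sat v \<psi>"
| "sat v (All i \<phi>) \<longleftrightarrow> (\<forall>a. sat (v(i := a)) \<phi>)"

definition subset_of :: "'a \<Rightarrow> 'a \<Rightarrow> bool" where
  "subset_of x y \<longleftrightarrow> (\<forall>z. z \<epsilon> x \<longrightarrow> z \<epsilon> y)"

definition is_empty :: "'a \<Rightarrow> bool" where
  "is_empty x \<longleftrightarrow> (\<forall>z. \<not> z \<epsilon> x)"

definition is_succ :: "'a \<Rightarrow> 'a \<Rightarrow> bool" where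
  "is_succ x y \<longleftrightarrow> (\<forall>z. z \<epsilon> y \<longleftrightarrow> z \<epsilon> x \<or> z = x)"

definition is_inductive :: "'a \<Rightarrow> bool" where
  "is_inductive u \<longleftrightarrow>
     (\<exists>e. is_empty e \<and> e \<epsilon> u) \<and> (\<forall>x. x \<epsilon> u \<longrightarrow> (\<exists>y. is_succ x y \<and> y \<epsilon> u))"

definition is_union :: "'a \<Rightarrow> 'a \<Rightarrow> bool" where
  "is_union F u \<longleftrightarrow> (\<forall>z. z \<epsilon> u \<longleftrightarrow> (\<exists>A. A \<epsilon> F \<and> z \<epsilon> A))"

definition is_upair :: "'a \<Rightarrow> 'a \<Rightarrow> 'a \<Rightarrow> bool" where
  "is_upair a b c \<longleftrightarrow> (\<forall>z. z \<epsilon> c \<longleftrightarrow> z = a \<or> z = b)"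

text \<open>Kuratowski pairs\<close>
definition is_pair :: "'a \<Rightarrow> 'a \<Rightarrow> 'a \<Rightarrow> bool" where
  "is_pair a b c \<longleftrightarrow> (\<exists>u v. is_upair a a u \<and> is_upair a b v \<and> is_upair u v c)"

definition pair_in :: "'a \<Rightarrow> 'a \<Rightarrow> 'a \<Rightarrow> bool" where
  "pair_in a b r \<longleftrightarrow> (\<exists>c. is_pair a b c \<and> c \<epsilon> r)"

definition is_product :: "'a \<Rightarrow> 'a \<Rightarrow> 'a \<Rightarrow> bool" where
  "is_product x y c \<longleftrightarrow> (\<forall>z. z \<epsilon> c \<longleftrightarrow> (\<exists>a b. a \<epsilon> x \<and> b \<epsilon> y \<and> is_pair a b z))"

definition is_function :: "'a \<Rightarrow> 'a \<Rightarrow> 'a \<Rightarrow> bool" where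
  "is_function f x y \<longleftrightarrow>
     (\<forall>z. z \<epsilon> f \<longrightarrow> (\<exists>a b. a \<epsilon> x \<and> b \<epsilon> y \<and> is_pair a b z)) \<and>
     (\<forall>a. a \<epsilon> x \<longrightarrow> (\<exists>!b. pair_in a b f))"

definition is_function_space :: "'a \<Rightarrow> 'a \<Rightarrow> 'a \<Rightarrow> bool" where
  "is_function_space x y c \<longleftrightarrow> (\<forall>f. f \<epsilon> c \<longleftrightarrow> is_function f x y)"

definition equinumerous :: "'a \<Rightarrow> 'a \<Rightarrow> bool" where
  "equinumerous x y \<longleftrightarrow>
     (\<exists>f. is_function f x y \<and> (\<forall>b. b \<epsilon> y \<longrightarrow> (\<exists>!a. a \<epsilon> x \<and> pair_in a b f)))"

definition natural :: "'a \<Rightarrow> bool" where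
  "natural n \<longleftrightarrow> (\<forall>u. is_inductive u \<longrightarrow> n \<epsilon> u)"

definition finite_set :: "'a \<Rightarrow> bool" where
  "finite_set x \<longleftrightarrow> (\<exists>m. natural m \<and> equinumerous x m)"

text \<open>Finite and of cardinality greater than \<open>n\<close>\<close>
definition finite_gt :: "'a \<Rightarrow> 'a \<Rightarrow> bool" where
  "finite_gt n x \<longleftrightarrow> (\<exists>m. natural m \<and> n \<epsilon> m \<and> equinumerous x m)"

text \<open>Arithmetic on \<open>\<omega>\<close> is finite cardinal arithmetic: \<open>a \<cdot> b = |a \<times> b|\<close>, and \<open>a ^ b\<close> is the number of
  functions from \<open>b\<close> to \<open>a\<close>.\<close>
definition is_times :: "'a \<Rightarrow> 'a \<Rightarrow> 'a \<Rightarrow> bool" where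
  "is_times a b c \<longleftrightarrow> natural c \<and> (\<exists>s. is_product a b s \<and> equinumerous s c)"

definition is_power :: "'a \<Rightarrow> 'a \<Rightarrow> 'a \<Rightarrow> bool" where
  "is_power a b c \<longleftrightarrow> natural c \<and> (\<exists>s. is_function_space b a s \<and> equinumerous s c)"

definition is_one :: "'a \<Rightarrow> bool" where
  "is_one x \<longleftrightarrow> (\<exists>e. is_empty e \<and> is_succ e x)"

definition prime_number :: "'a \<Rightarrow> bool" where
  "prime_number p \<longleftrightarrow> natural p \<and> \<not> is_empty p \<and> \<not> is_one p \<and>
     (\<forall>a b. natural a \<and> natural b \<and> is_times a b p \<longrightarrow> is_one a \<or> is_one b)"

text \<open>\<open>D = [x]\<^sup>n\<close> and \<open>D = [x]\<close> with superscript \<open>> n\<close>\<close>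
definition is_subsets_eq :: "'a \<Rightarrow> 'a \<Rightarrow> 'a \<Rightarrow> bool" where
  "is_subsets_eq x n D \<longleftrightarrow> (\<forall>z. z \<epsilon> D \<longleftrightarrow> subset_of z x \<and> equinumerous z n)"

definition is_subsets_gt :: "'a \<Rightarrow> 'a \<Rightarrow> 'a \<Rightarrow> bool" where
  "is_subsets_gt x n D \<longleftrightarrow> (\<forall>z. z \<epsilon> D \<longleftrightarrow> subset_of z x \<and> finite_gt n z)"

text \<open>\<open>r\<close> is a strict well-ordering of \<open>x\<close>.\<close>
definition well_orders :: "'a \<Rightarrow> 'a \<Rightarrow> bool" where
  "well_orders r x \<longleftrightarrow>
     (\<forall>a. a \<epsilon> x \<longrightarrow> \<not> pair_in a a r) \<and>
     (\<forall>a b c. a \<epsilon> x \<and> b \<epsilon> x \<and> c \<epsilon> x \<and> pair_in a b r \<and> pair_in b c r \<longrightarrow> pair_in a c r) \<and>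
     (\<forall>a b. a \<epsilon> x \<and> b \<epsilon> x \<longrightarrow> a = b \<or> pair_in a b r \<or> pair_in b a r) \<and>
     (\<forall>s. subset_of s x \<and> \<not> is_empty s \<longrightarrow>
        (\<exists>a. a \<epsilon> s \<and> (\<forall>b. b \<epsilon> s \<longrightarrow> b = a \<or> pair_in a b r)))"

definition RC_fin :: "'a \<Rightarrow> bool" where
  "RC_fin n \<longleftrightarrow>
     (\<forall>x. \<not> finite_set x \<longrightarrow>
       (\<exists>y f D C. subset_of y x \<and> \<not> finite_set y \<and>
          is_subsets_gt y n D \<and> is_subsets_eq y n C \<and> is_function f D C \<and>
          (\<forall>z w. pair_in z w f \<longrightarrow> subset_of w z)))"

definition WOC_minus_fin :: "'a \<Rightarrow> bool" where
  "WOC_minus_fin n \<longleftrightarrow>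
     (\<forall>F. \<not> finite_set F \<and> (\<exists>r. well_orders r F) \<and> (\<forall>A. A \<epsilon> F \<longrightarrow> finite_gt n A) \<longrightarrow>
       (\<exists>G f U C. subset_of G F \<and> \<not> finite_set G \<and>
          is_union G U \<and> is_subsets_eq U n C \<and> is_function f G C \<and>
          (\<forall>A w. pair_in A w f \<longrightarrow> subset_of w A)))"

end

locale ZF_model = set_structure +
  assumes extensionality: "\<forall>x y. (\<forall>z. z \<epsilon> x \<longleftrightarrow> z \<epsilon> y) \<longrightarrow> x = y"
    and foundation: "\<forall>x. \<not> is_empty x \<longrightarrow> (\<exists>y. y \<epsilon> x \<and> \<not> (\<exists>z. z \<epsilon> x \<and> z \<epsilon> y))"
    and pairing: "\<forall>a b. \<exists>c. is_upair a b c"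
    and union: "\<forall>F. \<exists>u. is_union F u"
    and power_set: "\<forall>x. \<exists>y. \<forall>z. z \<epsilon> y \<longleftrightarrow> subset_of z x"
    and infinity: "\<exists>u. is_inductive u"
    and separation: "\<forall>\<phi> v A. \<exists>B. \<forall>x. x \<epsilon> B \<longleftrightarrow> x \<epsilon> A \<and> sat (v(0 := x)) \<phi>"
    and replacement: "\<forall>\<phi> v A.
      (\<forall>x y y'. x \<epsilon> A \<and> sat (v(0 := x, 1 := y)) \<phi> \<and> sat (v(0 := x, 1 := y')) \<phi> \<longrightarrow> y = y') \<longrightarrow>
      (\<exists>B. \<forall>y. y \<epsilon> B \<longleftrightarrow> (\<exists>x. x \<epsilon> A \<and> sat (v(0 := x, 1 := y)) \<phi>))"

end

theory Submission
  imports Defs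
begin

text \<open>
  By internal Euclid, the divisors of \<open>n = p\<^sup>k\<close> form a chain under divisibility. A well-ordered infinite
  family has an infinite subfamily all of whose initial segments are finite; let \<open>X\<close> be its disjoint
  union. Applying the Ramsey choice principle to a subset of \<open>X\<close> meeting infinitely many members
  \<open>A\<close> yields, for infinitely many \<open>A\<close>, subsets of one fixed size \<open>d\<close> dividing \<open>n\<close>: take the
  least nonzero size \<open>m\<close> that occurs; if \<open>m\<close> did not divide \<open>n\<close>, then an \<open>n\<close>-element subset of
  a large finite union of \<open>m\<close>-element pieces would cut one of the pieces properly. Removing pieces
  repeatedly, always of the largest divisor size available, every piece has a size dividing all the
  previous sizes and hence the running total \<open>t\<close>. Since a new size \<open>d\<close> divides \<open>n\<close> and \<open>t < n\<close>, we
  have \<open>t + d \<le> n\<close>, so the totals cannot jump over \<open>n\<close> and eventually equal it.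
\<close>

section \<open>Definability with parameters\<close>

text \<open>Two constraints shape the development. Separation and internal induction reach only
  first-order formulas with parameters, so every term and predicate that enters a set or an
  induction has to be proved definable; the \<open>definability\<close> rules do this along the
  syntax. And choices must not accumulate: the number of greedy stages is an internal natural
  number, so each stage asserts only that some subfamily \<open>D\<close> and set \<open>s\<close>
  exist, and the induction carries this existence along. Within a stage, elements are chosen either
  by one function obtained from \<open>RC_fin\<close> or as least elements of the well-ordering.
  Finite initial segments are wanted because a cut piece per finite union must yield infinitely many
  cut pieces. The unions run over blocks starting at \<open>i\<close>, so the piece cut for
  \<open>i\<close> has an index \<open>j\<close> at or after \<open>i\<close>, and finitely many
  such \<open>j\<close> would bound every \<open>i\<close>. Cut pieces may have varying sizes;
  pigeonhole makes them constant on an infinite subfamily before minimality of \<open>m\<close> is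
  contradicted.\<close>

primrec rename_fm :: "(nat \<Rightarrow> nat) \<Rightarrow> fm \<Rightarrow> fm" where
  "rename_fm f (Mem i j) = Mem (f i) (f j)"
| "rename_fm f (Eql i j) = Eql (f i) (f j)"
| "rename_fm f (Neg \<phi>) = Neg (rename_fm f \<phi>)"
| "rename_fm f (Conj \<phi> \<psi>) = Conj (rename_fm f \<phi>) (rename_fm f \<psi>)"
| "rename_fm f (All i \<phi>) = All (f i) (rename_fm f \<phi>)"

definition merge_env :: "(nat \<Rightarrow> 'a) \<Rightarrow> (nat \<Rightarrow> 'a) \<Rightarrow> nat \<Rightarrow> 'a" where
  "merge_env v w i = (if even i then v (i div 2) else w (i div 2))"

lemma merge_env_even [simp]: "merge_env v w (2 * i) = v i"
  and merge_env_odd [simp]: "merge_env v w (Suc (2 * i)) = w i"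
  by (simp_all add: merge_env_def)

lemma merge_env_zero [simp]: "merge_env v w 0 = v 0"
  by (simp add: merge_env_def)

lemma parity_cases:
  fixes i :: nat
  obtains k where "i = 2 * k" | k where "i = Suc (2 * k)"
  by (metis dvdE oddE Suc_eq_plus1)

lemma merge_env_eqI:
  assumes "\<And>i. h (2 * i) = v i" "\<And>i. h (Suc (2 * i)) = w i"
  shows "h = merge_env v w"
proof
  fix i show "h i = merge_env v w i" by (rule parity_cases[of i]) (simp_all add: assms)
qed

lemma inj_merge_env:
  assumes "\<And>i j. f i = f j \<Longrightarrow> i = j" "\<And>i j. g i = g j \<Longrightarrow> i = j" "\<And>i j. f i \<noteq> g j"
  shows "inj (merge_env f g)"
proof (rule injI)
  fix i j assume "merge_env f g i = merge_env f g j"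
  then show "i = j"
    by (rule_tac parity_cases[of i]; rule_tac parity_cases[of j])
      (auto dest: assms(1,2) assms(3)[THEN notE] assms(3)[THEN not_sym, THEN notE])
qed

named_theorems definability

context set_structure
begin

text \<open>Injectivity of \<open>f\<close> rules out capture: updating variable \<open>f i\<close>
  changes the pulled-back environment at \<open>i\<close> only.\<close>

lemma sat_rename_fm: "inj f \<Longrightarrow> sat v (rename_fm f \<phi>) = sat (\<lambda>i. v (f i)) \<phi>"
proof (induction \<phi> arbitrary: v)
  case (All i \<phi>)
  have "(\<lambda>j. (v(f i := a)) (f j)) = (\<lambda>j. v (f j))(i := a)" for a
    using All.prems by (auto simp: inj_eq)
  then show ?case using All by simp
qed auto

text \<open>The arguments of a predicate sit in the even variables and the hidden parameters in the odd
  ones, so that predicates with different parameters can be combined by renaming variables.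
  A quantified variable becomes entry 0 of the environment, as a de Bruijn index.\<close>
definition definable :: "((nat \<Rightarrow> 'a) \<Rightarrow> bool) \<Rightarrow> bool" where
  "definable P \<longleftrightarrow> (\<exists>\<phi> w. \<forall>v. P v = sat (merge_env v w) \<phi>)"

lemma definableI: "(\<And>v. P v = sat (merge_env v w) \<phi>) \<Longrightarrow> definable P"
  unfolding definable_def by blast

text \<open>The arguments are moved by \<open>f\<close>, while \<open>g\<close> fixes the odd
  variables and with them the hidden parameters.\<close>

lemma definable_rename_fm:
  assumes "definable P" "inj f"
  shows "definable (\<lambda>v. P (\<lambda>i. v (f i)))"
proof -
  obtain \<phi> w where *: "\<And>v. P v = sat (merge_env v w) \<phi>"
    using assms unfolding definable_def by blast
  define g where "g = merge_env (\<lambda>i. 2 * f i) (\<lambda>i. Suc (2 * i))"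
  have g: "inj g" unfolding g_def
    using assms(2) by (intro inj_merge_env) (auto simp: inj_eq, presburger)
  have "(\<lambda>i. merge_env v w (g i)) = merge_env (\<lambda>i. v (f i)) w" for v
    by (rule merge_env_eqI) (simp_all add: g_def)
  then show ?thesis
    by (intro definableI[where w = w and \<phi> = "rename_fm g \<phi>"]) (simp add: * sat_rename_fm[OF g])
qed

lemma definable_not [definability]:
  assumes "definable P" shows "definable (\<lambda>v. \<not> P v)"
proof -
  obtain \<phi> w where *: "\<And>v. P v = sat (merge_env v w) \<phi>"
    using assms unfolding definable_def by blast
  show ?thesis by (rule definableI[where w = w and \<phi> = "Neg \<phi>"]) (simp add: *)
qed

lemma definable_conj [definability]:
  assumes "definable P" "definable Q" shows "definable (\<lambda>v. P v \<and> Q v)"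
proof -
  obtain \<phi> w where P: "\<And>v. P v = sat (merge_env v w) \<phi>"
    using assms unfolding definable_def by blast
  obtain \<psi> u where Q: "\<And>v. Q v = sat (merge_env v u) \<psi>"
    using assms unfolding definable_def by blast
  \<comment> \<open>The two parameter sequences are interleaved once more: \<open>w\<close> takes
    the even parameter slots and \<open>u\<close> the odd ones, while the arguments stay
    shared.\<close>
  define f where "f = merge_env (\<lambda>i. 2 * i) (\<lambda>i. Suc (2 * (2 * i)))"
  define g where "g = merge_env (\<lambda>i. 2 * i) (\<lambda>i. Suc (2 * Suc (2 * i)))"
  have f: "inj f" unfolding f_def by (rule inj_merge_env) (simp_all, presburger)
  have g: "inj g" unfolding g_def by (rule inj_merge_env) (simp_all, presburger)
  have 1: "(\<lambda>i. merge_env v (merge_env w u) (f i)) = merge_env v w" for v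
    by (rule merge_env_eqI) (simp_all only: f_def merge_env_even merge_env_odd)
  have 2: "(\<lambda>i. merge_env v (merge_env w u) (g i)) = merge_env v u" for v
    by (rule merge_env_eqI) (simp_all only: g_def merge_env_even merge_env_odd)
  show ?thesis
    by (rule definableI[where w = "merge_env w u" and \<phi> = "Conj (rename_fm f \<phi>) (rename_fm g \<psi>)"])
      (simp add: sat_rename_fm[OF f] sat_rename_fm[OF g] 1 2 P Q)
qed

lemma definable_all [definability]:
  assumes "definable (\<lambda>v. Q (\<lambda>i. v (Suc i)) (v 0))"
  shows "definable (\<lambda>v. \<forall>x. Q v x)"
proof -
  obtain \<phi> w where *: "\<And>v. Q (\<lambda>i. v (Suc i)) (v 0) = sat (merge_env v w) \<phi>"
    using assms unfolding definable_def by blast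
  \<comment> \<open>The bound variable has to leave the even positions, which the outer arguments
    fill completely. It moves to variable 1, the parameters shift up by one slot, and entry 0 of
    \<open>w'\<close> is a dummy that the quantifier overwrites.\<close>
  define f where "f = merge_env (case_nat 1 (\<lambda>i. 2 * i)) (\<lambda>i. Suc (2 * Suc i))"
  define w' where "w' = case_nat (w 0) w"
  have f: "inj f" unfolding f_def
    by (rule inj_merge_env) (simp_all split: nat.splits, presburger+)
  have "(\<lambda>i. ((merge_env v w')(1 := x)) (f i)) = merge_env (case_nat x v) w" for v x
  proof (rule merge_env_eqI)
    fix i
    have "2 * k \<noteq> (1 :: nat)" for k by presburger
    then show "((merge_env v w')(1 := x)) (f (2 * i)) = case_nat x v i"
      by (simp add: f_def split: nat.splits)
    have "f (Suc (2 * i)) = Suc (2 * Suc i)" by (simp only: f_def merge_env_odd)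
    then show "((merge_env v w')(1 := x)) (f (Suc (2 * i))) = w i"
      by (simp only: merge_env_odd fun_upd_apply) (simp add: w'_def)
  qed
  then have "sat (merge_env v w') (All 1 (rename_fm f \<phi>)) = (\<forall>x. Q v x)" for v
    using *[of "case_nat _ v"] by (simp add: sat_rename_fm[OF f])
  from this[symmetric] show ?thesis by (rule definableI)
qed

lemma definable_mem_var: "definable (\<lambda>v. v i \<epsilon> v j)"
  by (rule definableI[where \<phi> = "Mem (2 * i) (2 * j)"]) simp

lemma definable_eq_var: "definable (\<lambda>v. v i = v j)"
  by (rule definableI[where \<phi> = "Eql (2 * i) (2 * j)"]) simp

lemma definable_eq_const: "definable (\<lambda>v. v i = c)"
  by (rule definableI[where \<phi> = "Eql (2 * i) 1" and w = "\<lambda>_. c"]) (simp add: merge_env_def)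

lemma definable_const [definability]: "definable (\<lambda>v. c)"
  by (cases c; rule definableI[where \<phi> = "Eql 0 0"] definableI[where \<phi> = "Neg (Eql 0 0)"]) auto

lemma definable_disj [definability]: "definable P \<Longrightarrow> definable Q \<Longrightarrow> definable (\<lambda>v. P v \<or> Q v)"
  using definable_not[OF definable_conj[OF definable_not definable_not]] by simp

lemma definable_imp [definability]: "definable P \<Longrightarrow> definable Q \<Longrightarrow> definable (\<lambda>v. P v \<longrightarrow> Q v)"
  using definable_disj[OF definable_not] by simp

lemma definable_iff [definability]:
  assumes "definable P" "definable Q" shows "definable (\<lambda>v. P v \<longleftrightarrow> Q v)"
  unfolding iff_conv_conj_imp by (intro definable_conj definable_imp assms)

lemma definable_ex [definability]:
  "definable (\<lambda>v. Q (\<lambda>i. v (Suc i)) (v 0)) \<Longrightarrow> definable (\<lambda>v. \<exists>x. Q v x)"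
  using definable_not[OF definable_all[OF definable_not]] by simp

text \<open>Entry 1 of the environment is skipped: it holds the variable of an additional binder
  standing between the original environment and the bound variable in entry 0.\<close>

lemma definable_shift2:
  assumes "definable (\<lambda>v. Q (\<lambda>i. v (Suc i)) (v 0))"
  shows "definable (\<lambda>v. Q (\<lambda>i. v (Suc (Suc i))) (v 0))"
  using definable_rename_fm[OF assms, of "case_nat 0 (\<lambda>i. Suc (Suc i))"]
  by (auto simp: inj_def split: nat.splits)

lemma definable_ex1 [definability]:
  assumes "definable (\<lambda>v. Q (\<lambda>i. v (Suc i)) (v 0))"
  shows "definable (\<lambda>v. \<exists>!x. Q v x)"
proof -
  \<comment> \<open>In this form \<open>Q\<close> occurs only once, with the inner bound variable,
    so a single use of \<open>definable_shift2\<close> suffices.\<close>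
  have "(\<lambda>v. \<exists>!x. Q v x) = (\<lambda>v. \<exists>x. \<forall>y. Q v y \<longleftrightarrow> y = x)" by (intro ext) metis
  then show ?thesis
    by (simp only:) (intro definable_ex definable_all definable_iff definable_eq_var definable_shift2[OF assms])
qed

section \<open>Definable terms and their composition\<close>

definition definable_fun :: "((nat \<Rightarrow> 'a) \<Rightarrow> 'a) \<Rightarrow> bool" where
  "definable_fun t \<longleftrightarrow> definable (\<lambda>v. v 0 = t (\<lambda>i. v (Suc i)))"

lemma definable_fun_var [definability]: "definable_fun (\<lambda>v. v i)"
  unfolding definable_fun_def by (rule definable_eq_var)

lemma definable_fun_const [definability]: "definable_fun (\<lambda>v. c)"
  unfolding definable_fun_def by (rule definable_eq_const)

lemma definable_fun_shift: "definable_fun t \<Longrightarrow> definable_fun (\<lambda>v. t (\<lambda>i. v (Suc i)))"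
  unfolding definable_fun_def
  by (rule definable_shift2[where Q = "\<lambda>v x. x = t v"])

text \<open>Substituting a definable term means passing through an intermediate bound variable. The
  composition rules \<open>D1D\<close> to \<open>F3D\<close> reduce to this.\<close>

lemma definable_let:
  assumes "definable_fun t" "definable (\<lambda>v. Q (\<lambda>i. v (Suc i)) (v 0))"
  shows "definable (\<lambda>v. Q v (t v))"
proof -
  have "(\<lambda>v. Q v (t v)) = (\<lambda>v. \<exists>x. x = t v \<and> Q v x)" by auto
  then show ?thesis using assms
    by (simp only: definable_fun_def) (intro definable_ex definable_conj)
qed

text \<open>A constant is proved definable once in this curried form; the composition rules below
  then cover its application to arbitrary definable terms.\<close>

definition D1 :: "('a \<Rightarrow> bool) \<Rightarrow> bool" where
  "D1 P \<longleftrightarrow> definable (\<lambda>v. P (v 0))"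
definition D2 :: "('a \<Rightarrow> 'a \<Rightarrow> bool) \<Rightarrow> bool" where
  "D2 P \<longleftrightarrow> definable (\<lambda>v. P (v 0) (v 1))"
definition D3 :: "('a \<Rightarrow> 'a \<Rightarrow> 'a \<Rightarrow> bool) \<Rightarrow> bool" where
  "D3 P \<longleftrightarrow> definable (\<lambda>v. P (v 0) (v 1) (v 2))"
definition D4 :: "('a \<Rightarrow> 'a \<Rightarrow> 'a \<Rightarrow> 'a \<Rightarrow> bool) \<Rightarrow> bool" where
  "D4 P \<longleftrightarrow> definable (\<lambda>v. P (v 0) (v 1) (v 2) (v 3))"
definition F1 :: "('a \<Rightarrow> 'a) \<Rightarrow> bool" where
  "F1 f \<longleftrightarrow> definable_fun (\<lambda>v. f (v 0))"
definition F2 :: "('a \<Rightarrow> 'a \<Rightarrow> 'a) \<Rightarrow> bool" where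
  "F2 f \<longleftrightarrow> definable_fun (\<lambda>v. f (v 0) (v 1))"
definition F3 :: "('a \<Rightarrow> 'a \<Rightarrow> 'a \<Rightarrow> 'a) \<Rightarrow> bool" where
  "F3 f \<longleftrightarrow> definable_fun (\<lambda>v. f (v 0) (v 1) (v 2))"

lemma D1D:
  assumes "D1 P" "definable_fun a" shows "definable (\<lambda>v. P (a v))"
  by (rule definable_let[OF assms(2), where Q = "\<lambda>v x. P x"]) (use assms(1) in \<open>simp add: D1_def\<close>)

lemma D2D:
  assumes "D2 P" "definable_fun a" "definable_fun b" shows "definable (\<lambda>v. P (a v) (b v))"
  apply (rule definable_let[OF assms(3), where Q = "\<lambda>v x. P (a v) x"])
  apply (rule definable_let[OF definable_fun_shift[OF assms(2)], where Q = "\<lambda>v x. P x (v 0)"])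
  using assms(1) by (simp add: D2_def)

lemma D3D:
  assumes "D3 P" "definable_fun a" "definable_fun b" "definable_fun c" shows "definable (\<lambda>v. P (a v) (b v) (c v))"
  apply (rule definable_let[OF assms(4), where Q = "\<lambda>v x. P (a v) (b v) x"])
  apply (rule definable_let[OF definable_fun_shift[OF assms(3)], where Q = "\<lambda>v x. P (a (\<lambda>i. v (Suc i))) x (v 0)"])
  apply (rule definable_let[OF definable_fun_shift[OF definable_fun_shift[OF assms(2)]], where Q = "\<lambda>v x. P x (v 0) (v (Suc 0))"])
  using assms(1) by (simp add: D3_def numeral_2_eq_2)

lemma D4D:
  assumes "D4 P" "definable_fun a" "definable_fun b" "definable_fun c" "definable_fun d" shows "definable (\<lambda>v. P (a v) (b v) (c v) (d v))"
  apply (rule definable_let[OF assms(5), where Q = "\<lambda>v x. P (a v) (b v) (c v) x"])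
  apply (rule definable_let[OF definable_fun_shift[OF assms(4)],
        where Q = "\<lambda>v x. P (a (\<lambda>i. v (Suc i))) (b (\<lambda>i. v (Suc i))) x (v 0)"])
  apply (rule definable_let[OF definable_fun_shift[OF definable_fun_shift[OF assms(3)]],
        where Q = "\<lambda>v x. P (a (\<lambda>i. v (Suc (Suc i)))) x (v 0) (v (Suc 0))"])
  apply (rule definable_let[OF definable_fun_shift[OF definable_fun_shift[OF definable_fun_shift[OF assms(2)]]],
        where Q = "\<lambda>v x. P x (v 0) (v (Suc 0)) (v (Suc (Suc 0)))"])
  using assms(1) by (simp add: D4_def numeral_2_eq_2 numeral_3_eq_3)

lemma definable_eq [definability]: "definable_fun a \<Longrightarrow> definable_fun b \<Longrightarrow> definable (\<lambda>v. a v = b v)"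
  by (rule D2D) (simp_all add: D2_def definable_eq_var)

lemma definable_mem [definability]: "definable_fun a \<Longrightarrow> definable_fun b \<Longrightarrow> definable (\<lambda>v. a v \<epsilon> b v)"
  by (rule D2D) (simp_all add: D2_def definable_mem_var)

lemma F1D:
  assumes "F1 f" "definable_fun a" shows "definable_fun (\<lambda>v. f (a v))"
  unfolding definable_fun_def
  by (rule D2D[where P = "\<lambda>y x. y = f x", OF _ definable_fun_var definable_fun_shift[OF assms(2)]])
    (use assms(1) in \<open>simp add: D2_def F1_def definable_fun_def\<close>)

lemma F2D:
  assumes "F2 f" "definable_fun a" "definable_fun b" shows "definable_fun (\<lambda>v. f (a v) (b v))"
  unfolding definable_fun_def
  by (rule D3D[where P = "\<lambda>y x z. y = f x z", OF _ definable_fun_var definable_fun_shift[OF assms(2)] definable_fun_shift[OF assms(3)]])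
    (use assms(1) in \<open>simp add: D3_def F2_def definable_fun_def numeral_2_eq_2\<close>)

lemma F3D:
  assumes "F3 f" "definable_fun a" "definable_fun b" "definable_fun c" shows "definable_fun (\<lambda>v. f (a v) (b v) (c v))"
  unfolding definable_fun_def
  by (rule D4D[where P = "\<lambda>y x z u. y = f x z u", OF _ definable_fun_var definable_fun_shift[OF assms(2)] definable_fun_shift[OF assms(3)] definable_fun_shift[OF assms(4)]])
    (use assms(1) in \<open>simp add: D4_def F3_def definable_fun_def numeral_2_eq_2 numeral_3_eq_3\<close>)

lemma D2I: "definable (\<lambda>v. P (v 0) (v (Suc 0))) \<Longrightarrow> D2 P" by (simp add: D2_def)
lemma D3I: "definable (\<lambda>v. P (v 0) (v (Suc 0)) (v (Suc (Suc 0)))) \<Longrightarrow> D3 P"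
  by (simp add: D3_def numeral_2_eq_2)
lemma D4I: "definable (\<lambda>v. P (v 0) (v (Suc 0)) (v (Suc (Suc 0))) (v (Suc (Suc (Suc 0))))) \<Longrightarrow> D4 P"
  by (simp add: D4_def numeral_2_eq_2 numeral_3_eq_3)
lemma D1I: "definable (\<lambda>v. P (v 0)) \<Longrightarrow> D1 P" by (simp add: D1_def)
lemma F1I: "definable_fun (\<lambda>v. f (v 0)) \<Longrightarrow> F1 f" by (simp add: F1_def)
lemma F2I: "definable_fun (\<lambda>v. f (v 0) (v (Suc 0))) \<Longrightarrow> F2 f" by (simp add: F2_def)
lemma F3I: "definable_fun (\<lambda>v. f (v 0) (v (Suc 0)) (v (Suc (Suc 0)))) \<Longrightarrow> F3 f"
  by (simp add: F3_def numeral_2_eq_2)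

lemmas definable_intros [definability] = D1I D2I D3I D4I F1I F2I F3I

text \<open>Unlike \<open>THE\<close>, this description operator has a definable value also where no unique
  witness exists.\<close>
definition descr :: "('a \<Rightarrow> bool) \<Rightarrow> 'a" where
  "descr P = (if \<exists>!x. P x then THE x. P x else (SOME e. True))"

lemma descr_eq: "P a \<Longrightarrow> (\<And>x. P x \<Longrightarrow> x = a) \<Longrightarrow> descr P = a"
  unfolding descr_def by (metis the_equality)

lemma the1I: "\<exists>!x. P x \<Longrightarrow> P (descr P)"
  unfolding descr_def by (simp add: theI')

lemma definable_fun_descr [definability]:
  assumes "definable (\<lambda>v. Q (\<lambda>i. v (Suc i)) (v 0))"
  shows "definable_fun (\<lambda>v. descr (Q v))"
proof -
  \<comment> \<open>The graph of \<open>descr\<close> splits into two first-order cases, a unique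
    witness or the default, and the default element enters as a hidden parameter.\<close>
  have *: "(z = descr P) = ((\<forall>y. P y \<longleftrightarrow> y = z) \<or> (\<not> (\<exists>!y. P y) \<and> z = (SOME e. True)))"
    for z and P :: "'a \<Rightarrow> bool"
  proof (cases "\<exists>!y. P y")
    case True
    then have "P (descr P)" by (rule the1I)
    then show ?thesis using True by metis
  next
    case False
    then have "descr P = (SOME e. True)" unfolding descr_def by (rule if_not_P)
    then show ?thesis using False by metis
  qed
  show ?thesis unfolding definable_fun_def *
    by (intro definable_disj definable_conj definable_not definable_eq definable_fun_var definable_fun_const definable_all definable_iff definable_ex1 definable_shift2[OF assms]
        definable_shift2[OF definable_shift2[OF assms]])
qed

lemma definable_fun_if [definability]:
  assumes "definable P" "definable_fun a" "definable_fun b"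
  shows "definable_fun (\<lambda>v. if P v then a v else b v)"
proof -
  have "(\<lambda>v. v 0 = (if P (\<lambda>i. v (Suc i)) then a (\<lambda>i. v (Suc i)) else b (\<lambda>i. v (Suc i)))) =
    (\<lambda>v. (P (\<lambda>i. v (Suc i)) \<and> v 0 = a (\<lambda>i. v (Suc i))) \<or>
      (\<not> P (\<lambda>i. v (Suc i)) \<and> v 0 = b (\<lambda>i. v (Suc i))))" by auto
  then show ?thesis unfolding definable_fun_def
    by (simp only:) (intro definable_disj definable_conj definable_not definable_eq definable_fun_var definable_fun_shift assms definable_rename_fm[where P = P] inj_Suc)
qed

lemma D2_subset: "D2 subset_of" unfolding subset_of_def by (intro definability)
lemma D1_empty: "D1 is_empty" unfolding is_empty_def by (intro definability)
lemma D2_succ: "D2 is_succ" unfolding is_succ_def by (intro definability)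
lemmas [definability] = D2_subset[THEN D2D] D1_empty[THEN D1D] D2_succ[THEN D2D]
lemma D1_inductive: "D1 is_inductive" unfolding is_inductive_def by (intro definability)
lemma D3_upair: "D3 is_upair" unfolding is_upair_def by (intro definability)
lemmas [definability] = D1_inductive[THEN D1D] D3_upair[THEN D3D]
lemma D3_is_pair: "D3 is_pair" unfolding is_pair_def by (intro definability)
lemmas [definability] = D3_is_pair[THEN D3D]
lemma D3_pair_in: "D3 pair_in" unfolding pair_in_def by (intro definability)
lemmas [definability] = D3_pair_in[THEN D3D]
lemma D3_function: "D3 is_function" unfolding is_function_def by (intro definability)
lemmas [definability] = D3_function[THEN D3D]
lemma D2_equinumerous: "D2 equinumerous" unfolding equinumerous_def by (intro definability)
lemma D1_natural: "D1 natural" unfolding natural_def by (intro definability)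
lemmas [definability] = D2_equinumerous[THEN D2D] D1_natural[THEN D1D]
lemma D1_finite_set: "D1 finite_set" unfolding finite_set_def by (intro definability)
lemmas [definability] = D1_finite_set[THEN D1D]

end

section \<open>Set operations\<close>

context ZF_model
begin

lemma set_ext: "(\<And>z. z \<epsilon> x \<longleftrightarrow> z \<epsilon> y) \<Longrightarrow> x = y"
  using extensionality by blast

lemma sep_ex:
  assumes "D1 P" shows "\<exists>B. \<forall>x. x \<epsilon> B \<longleftrightarrow> x \<epsilon> A \<and> P x"
proof -
  obtain \<phi> w where *: "\<And>v. P (v 0) = sat (merge_env v w) \<phi>"
    using assms unfolding D1_def definable_def by blast
  \<comment> \<open>\<open>P\<close> sees argument 0 only, so the other even variables may hold
    anything. Filling them from \<open>w\<close> gives one environment that serves all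
    \<open>x\<close>.\<close>
  define v where "v = merge_env w w"
  have "(merge_env w w)(0 := x) = merge_env (w(0 := x)) w" for x
    by (rule merge_env_eqI) auto
  then have "P x = sat (v(0 := x)) \<phi>" for x
    using *[of "w(0 := x)"] by (simp add: v_def)
  then show ?thesis using separation by simp
qed

lemma set_descr:
  assumes "\<exists>B. \<forall>x. x \<epsilon> B \<longleftrightarrow> P x"
  shows "x \<epsilon> descr (\<lambda>B. \<forall>x. x \<epsilon> B \<longleftrightarrow> P x) \<longleftrightarrow> P x"
proof -
  have "\<exists>!B. \<forall>x. x \<epsilon> B \<longleftrightarrow> P x" using assms by (auto intro: set_ext)
  from the1I[OF this] show ?thesis by blast
qed

text \<open>Going through \<open>descr\<close> makes the separated set a definable term, which may
  occur inside further predicates.\<close>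

definition sep :: "'a \<Rightarrow> ('a \<Rightarrow> bool) \<Rightarrow> 'a" where
  "sep A P = descr (\<lambda>B. \<forall>x. x \<epsilon> B \<longleftrightarrow> x \<epsilon> A \<and> P x)"

lemma mem_sep: "D1 P \<Longrightarrow> x \<epsilon> sep A P \<longleftrightarrow> x \<epsilon> A \<and> P x"
  unfolding sep_def by (rule set_descr) (rule sep_ex)

lemma definable_fun_sep [definability]:
  assumes "definable_fun a" "definable (\<lambda>v. P (\<lambda>i. v (Suc i)) (v 0))"
  shows "definable_fun (\<lambda>v. sep (a v) (P v))"
  unfolding sep_def
  by (rule definable_fun_descr, intro definable_all definable_iff definable_mem definable_conj definable_fun_var definable_shift2 assms(2)
       definable_shift2[OF assms(2)] definable_fun_shift[OF assms(1)] definable_fun_shift[OF definable_fun_shift[OF assms(1)]])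

definition emp :: 'a where "emp = descr is_empty"
definition upair :: "'a \<Rightarrow> 'a \<Rightarrow> 'a" where
  "upair a b = descr (\<lambda>c. \<forall>z. z \<epsilon> c \<longleftrightarrow> z = a \<or> z = b)"
definition Union_of :: "'a \<Rightarrow> 'a" where
  "Union_of F = descr (\<lambda>u. \<forall>z. z \<epsilon> u \<longleftrightarrow> (\<exists>A. A \<epsilon> F \<and> z \<epsilon> A))"
definition Power :: "'a \<Rightarrow> 'a" where
  "Power x = descr (\<lambda>u. \<forall>z. z \<epsilon> u \<longleftrightarrow> subset_of z x)"
definition cup :: "'a \<Rightarrow> 'a \<Rightarrow> 'a" where "cup a b = Union_of (upair a b)"
definition ins :: "'a \<Rightarrow> 'a \<Rightarrow> 'a" where "ins a b = cup (upair a a) b"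
definition diff :: "'a \<Rightarrow> 'a \<Rightarrow> 'a" where "diff a b = sep a (\<lambda>z. \<not> z \<epsilon> b)"
definition pair :: "'a \<Rightarrow> 'a \<Rightarrow> 'a" where "pair a b = upair (upair a a) (upair a b)"
text \<open>A Kuratowski pair of elements of \<open>x\<close> and \<open>y\<close> is a set of
  subsets of \<open>cup x y\<close>, so the double power set is a bound from which separation can
  cut.\<close>

definition product :: "'a \<Rightarrow> 'a \<Rightarrow> 'a" where
  "product x y = sep (Power (Power (cup x y))) (\<lambda>z. \<exists>a b. a \<epsilon> x \<and> b \<epsilon> y \<and> z = pair a b)"
definition fst_of :: "'a \<Rightarrow> 'a" where "fst_of z = descr (\<lambda>a. \<exists>b. z = pair a b)"
definition snd_of :: "'a \<Rightarrow> 'a" where "snd_of z = descr (\<lambda>b. \<exists>a. z = pair a b)"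

lemma F2_upair: "F2 upair" unfolding upair_def by (intro definability)
lemma F1_Union_of: "F1 Union_of" unfolding Union_of_def by (intro definability)
lemma F1_Power: "F1 Power" unfolding Power_def by (intro definability)
lemmas [definability] = F2_upair[THEN F2D] F1_Union_of[THEN F1D] F1_Power[THEN F1D]
lemma F2_cup: "F2 cup" unfolding cup_def by (intro definability)
lemmas [definability] = F2_cup[THEN F2D]
lemma F2_ins: "F2 ins" unfolding ins_def by (intro definability)
lemma F2_diff: "F2 diff" unfolding diff_def by (intro definability)
lemma F2_pair: "F2 pair" unfolding pair_def by (intro definability)
lemmas [definability] = F2_ins[THEN F2D] F2_diff[THEN F2D] F2_pair[THEN F2D]
lemma F2_product: "F2 product" unfolding product_def by (intro definability)
lemma F1_fst_of: "F1 fst_of" unfolding fst_of_def by (intro definability)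
lemma F1_snd_of: "F1 snd_of" unfolding snd_of_def by (intro definability)
lemmas [definability] = F2_product[THEN F2D] F1_fst_of[THEN F1D] F1_snd_of[THEN F1D]

lemma not_mem_emp [simp]: "\<not> z \<epsilon> emp"
proof -
  have "\<exists>B. \<forall>x. x \<epsilon> B \<longleftrightarrow> False" using sep_ex[of "\<lambda>_. False"] by (auto intro: definability)
  from set_descr[OF this] show ?thesis by (simp add: emp_def is_empty_def[abs_def])
qed

lemma is_empty_iff: "is_empty x \<longleftrightarrow> x = emp"
  by (auto simp: is_empty_def intro: set_ext)

lemma mem_upair [simp]: "z \<epsilon> upair a b \<longleftrightarrow> z = a \<or> z = b"
  unfolding upair_def using pairing by (intro set_descr) (auto simp: is_upair_def)

lemma mem_Union_of [simp]: "z \<epsilon> Union_of F \<longleftrightarrow> (\<exists>A. A \<epsilon> F \<and> z \<epsilon> A)"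
  unfolding Union_of_def using union by (intro set_descr) (auto simp: is_union_def)

lemma mem_Power [simp]: "z \<epsilon> Power x \<longleftrightarrow> subset_of z x"
  unfolding Power_def using power_set by (intro set_descr) auto

lemma mem_cup [simp]: "z \<epsilon> cup a b \<longleftrightarrow> z \<epsilon> a \<or> z \<epsilon> b"
  by (auto simp: cup_def)

lemma mem_ins [simp]: "z \<epsilon> ins a b \<longleftrightarrow> z = a \<or> z \<epsilon> b"
  by (auto simp: ins_def)

lemma mem_diff [simp]: "z \<epsilon> diff a b \<longleftrightarrow> z \<epsilon> a \<and> \<not> z \<epsilon> b"
  unfolding diff_def by (subst mem_sep) (intro definability, simp)

lemma is_upair_iff: "is_upair a b c \<longleftrightarrow> c = upair a b"
  by (auto simp: is_upair_def intro: set_ext)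

lemma is_pair_iff: "is_pair a b c \<longleftrightarrow> c = pair a b"
  by (simp add: is_pair_def is_upair_iff pair_def)

lemma upair_eq: "upair a b = upair c d \<longleftrightarrow> (a = c \<and> b = d) \<or> (a = d \<and> b = c)"
proof
  assume *: "upair a b = upair c d"
  have "a \<epsilon> upair c d" "b \<epsilon> upair c d" unfolding *[symmetric] by simp_all
  moreover have "c \<epsilon> upair a b" "d \<epsilon> upair a b" unfolding * by simp_all
  ultimately show "(a = c \<and> b = d) \<or> (a = d \<and> b = c)" by auto
qed (auto intro: set_ext)

lemma pair_eq [simp]: "pair a b = pair c d \<longleftrightarrow> a = c \<and> b = d"
  by (auto simp: pair_def upair_eq)

lemma pair_in_iff: "pair_in a b r \<longleftrightarrow> pair a b \<epsilon> r"
  by (simp add: pair_in_def is_pair_iff)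

lemma fst_of_pair [simp]: "fst_of (pair a b) = a"
  unfolding fst_of_def by (rule descr_eq) auto
lemma snd_of_pair [simp]: "snd_of (pair a b) = b"
  unfolding snd_of_def by (rule descr_eq) auto

lemma mem_product: "z \<epsilon> product x y \<longleftrightarrow> (\<exists>a b. a \<epsilon> x \<and> b \<epsilon> y \<and> z = pair a b)"
proof -
  have "subset_of (pair a b) (Power (cup x y))" if "a \<epsilon> x" "b \<epsilon> y" for a b
    using that by (auto simp: subset_of_def pair_def)
  then show ?thesis unfolding product_def by (subst mem_sep) (intro definability, auto)
qed

lemma pair_mem_product [simp]: "pair a b \<epsilon> product x y \<longleftrightarrow> a \<epsilon> x \<and> b \<epsilon> y"
  by (auto simp: mem_product)

lemma is_product_iff: "is_product x y s \<longleftrightarrow> s = product x y"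
  by (auto simp: is_product_def is_pair_iff mem_product intro: set_ext)

lemma is_union_iff: "is_union F u \<longleftrightarrow> u = Union_of F"
  by (auto simp: is_union_def intro: set_ext)

lemma is_succ_iff: "is_succ x y \<longleftrightarrow> y = ins x x"
  by (auto simp: is_succ_def intro: set_ext)

section \<open>Functions and bijections inside the model\<close>

definition elts :: "'a \<Rightarrow> 'a set" where "elts A = {x. x \<epsilon> A}"

lemma mem_elts [simp]: "x \<in> elts A \<longleftrightarrow> x \<epsilon> A" by (simp add: elts_def)

definition graph_on :: "'a \<Rightarrow> 'a \<Rightarrow> ('a \<Rightarrow> 'a) \<Rightarrow> 'a" where
  "graph_on A B f = sep (product A B) (\<lambda>z. snd_of z = f (fst_of z))"

lemma pair_mem_graph_on:
  assumes "F1 f" shows "pair a b \<epsilon> graph_on A B f \<longleftrightarrow> a \<epsilon> A \<and> b \<epsilon> B \<and> b = f a"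
  unfolding graph_on_def by (subst mem_sep) (intro definability F1D[OF assms], auto)

lemma mem_graph_on:
  assumes "F1 f" shows "z \<epsilon> graph_on A B f \<longleftrightarrow> (\<exists>a. a \<epsilon> A \<and> f a \<epsilon> B \<and> z = pair a (f a))"
  unfolding graph_on_def by (subst mem_sep) (intro definability F1D[OF assms], auto simp: mem_product)

lemma is_function_graph_on:
  assumes "F1 f" "\<And>a. a \<epsilon> A \<Longrightarrow> f a \<epsilon> B"
  shows "is_function (graph_on A B f) A B"
  unfolding is_function_def using assms by (auto simp: pair_in_iff pair_mem_graph_on mem_graph_on is_pair_iff)

definition app :: "'a \<Rightarrow> 'a \<Rightarrow> 'a" where "app f x = descr (\<lambda>b. pair x b \<epsilon> f)"

lemma F2_app: "F2 app" unfolding app_def by (intro definability)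
lemmas [definability] = F2_app[THEN F2D]

lemma is_function_app:
  assumes "is_function f A B" "a \<epsilon> A"
  shows "app f a \<epsilon> B" "pair a b \<epsilon> f \<longleftrightarrow> b = app f a"
proof -
  have ex: "\<exists>!b. pair a b \<epsilon> f" using assms by (simp add: is_function_def pair_in_iff)
  then have "pair a (app f a) \<epsilon> f" unfolding app_def by (rule the1I)
  then show "pair a b \<epsilon> f \<longleftrightarrow> b = app f a" using ex by auto
  show "app f a \<epsilon> B" using assms \<open>pair a (app f a) \<epsilon> f\<close>
    by (fastforce simp: is_function_def is_pair_iff)
qed

text \<open>Definability of \<open>f\<close> is essential: an arbitrary HOL bijection between the
  element sets need not be represented in the model. Together with \<open>equinumerousE\<close> this
  lets counting arguments be carried out with \<open>bij_betw\<close>.\<close>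

lemma equinumerousI:
  assumes "F1 f" "bij_betw f (elts A) (elts B)"
  shows "equinumerous A B"
proof -
  have m: "a \<epsilon> A \<Longrightarrow> f a \<epsilon> B" for a using assms(2) by (auto simp: bij_betw_def)
  have "\<exists>!a. a \<epsilon> A \<and> b = f a" if "b \<epsilon> B" for b
  proof -
    from assms(2) that obtain a where "a \<epsilon> A" "b = f a"
      unfolding bij_betw_def by (metis imageE mem_elts)
    then show ?thesis using assms(2) unfolding bij_betw_def inj_on_def by auto
  qed
  then show ?thesis unfolding equinumerous_def
    using is_function_graph_on[OF assms(1), of A B] m
    by (intro exI[of _ "graph_on A B f"]) (auto simp: pair_in_iff pair_mem_graph_on[OF assms(1)])
qed

lemma equinumerousE:
  assumes "equinumerous A B"
  obtains f where "F1 f" "bij_betw f (elts A) (elts B)"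
proof -
  obtain g where g: "is_function g A B" "\<And>b. b \<epsilon> B \<Longrightarrow> \<exists>!a. a \<epsilon> A \<and> pair a b \<epsilon> g"
    using assms by (auto simp: equinumerous_def pair_in_iff)
  note g1 = is_function_app[OF g(1)]
  have "bij_betw (app g) (elts A) (elts B)" unfolding bij_betw_def
  proof (intro conjI inj_onI set_eqI iffI)
    fix x y assume "x \<in> elts A" "y \<in> elts A" "app g x = app g y"
    then show "x = y" using g(2)[of "app g x"] g1[of x] g1[of y] by auto
  next
    fix b assume "b \<in> elts B"
    then obtain a where "a \<epsilon> A" "pair a b \<epsilon> g" using g(2)[of b] by auto
    then show "b \<in> app g ` elts A" using g1 by auto
  qed (use g1 in auto)
  moreover have "F1 (app g)" by (intro definability)
  ultimately show ?thesis using that by blast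
qed

lemma equinumerous_refl: "equinumerous A A"
  by (rule equinumerousI[of "\<lambda>x. x"]) (rule F1I, rule definable_fun_var, auto simp: bij_betw_def)

lemma equinumerous_sym: assumes "equinumerous A B" shows "equinumerous B A"
proof -
  obtain f where f: "F1 f" "bij_betw f (elts A) (elts B)" using assms by (rule equinumerousE)
  define g where "g y = descr (\<lambda>x. x \<epsilon> A \<and> f x = y)" for y
  have "F1 g" unfolding g_def by (intro definability F1D[OF f(1)])
  have "g (f a) = a" if "a \<epsilon> A" for a
    using that f(2) unfolding g_def by (intro descr_eq) (auto simp: bij_betw_def inj_on_def)
  moreover have "b \<epsilon> B \<Longrightarrow> \<exists>a. a \<epsilon> A \<and> b = f a" for b
    using f(2) unfolding bij_betw_def by (metis imageE mem_elts)
  moreover have "f a \<epsilon> B" if "a \<epsilon> A" for a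
    using that f(2) unfolding bij_betw_def by auto
  moreover have "f (g b) = b \<and> g b \<epsilon> A" if "b \<epsilon> B" for b
    using that calculation by metis
  ultimately have "bij_betw g (elts B) (elts A)"
    by (intro bij_betw_byWitness[where f' = f]) auto
  with \<open>F1 g\<close> show ?thesis by (rule equinumerousI)
qed

lemma equinumerous_trans: assumes "equinumerous A B" "equinumerous B C" shows "equinumerous A C"
proof -
  obtain f where f: "F1 f" "bij_betw f (elts A) (elts B)" using assms(1) by (rule equinumerousE)
  obtain g where g: "F1 g" "bij_betw g (elts B) (elts C)" using assms(2) by (rule equinumerousE)
  show ?thesis
    by (rule equinumerousI[of "\<lambda>x. g (f x)"])
      (intro definability F1D[OF g(1)] F1D[OF f(1)], use bij_betw_trans[OF f(2) g(2)] in \<open>simp add: comp_def\<close>)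
qed

end

section \<open>Natural numbers and finite sets\<close>

context ZF_model
begin

definition suc :: "'a \<Rightarrow> 'a" where "suc n = ins n n"

lemma F1_suc: "F1 suc" unfolding suc_def by (intro definability)
lemmas [definability] = F1_suc[THEN F1D]

lemma mem_suc [simp]: "x \<epsilon> suc n \<longleftrightarrow> x = n \<or> x \<epsilon> n" by (simp add: suc_def)

lemma is_inductive_iff: "is_inductive u \<longleftrightarrow> emp \<epsilon> u \<and> (\<forall>x. x \<epsilon> u \<longrightarrow> suc x \<epsilon> u)"
  by (auto simp: is_inductive_def is_empty_iff is_succ_iff suc_def)

lemma natural_emp [simp]: "natural emp"
  and natural_suc [simp]: "natural n \<Longrightarrow> natural (suc n)"
  by (auto simp: natural_def is_inductive_iff)

text \<open>The internal \<open>\<omega>\<close> may be nonstandard, so induction is restricted to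
  definable \<open>P\<close>: separation then produces an inductive subset of a given inductive set.
  The case \<open>def\<close> is the definability obligation.\<close>

lemma natural_induct [consumes 1, case_names def emp suc]:
  assumes "natural n" and D: "D1 P" and 0: "P emp" and S: "\<And>n. natural n \<Longrightarrow> P n \<Longrightarrow> P (suc n)"
  shows "P n"
proof -
  obtain u where u: "is_inductive u" using infinity by blast
  have D': "D1 (\<lambda>x. natural x \<and> P x)" by (intro definability D1D[OF D])
  have "is_inductive (sep u (\<lambda>x. natural x \<and> P x))"
    using u 0 S by (auto simp: is_inductive_iff mem_sep[OF D'])
  then show ?thesis using assms(1) mem_sep[OF D'] unfolding natural_def by blast
qed

lemma mem_irrefl [simp]: "\<not> x \<epsilon> x"
proof
  assume "x \<epsilon> x"
  then show False using foundation[rule_format, of "upair x x"] by (auto simp: is_empty_def)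
qed

lemma mem_asym: "x \<epsilon> y \<Longrightarrow> \<not> y \<epsilon> x"
  using foundation[rule_format, of "upair x y"] by (auto simp: is_empty_def)

lemma natural_mem: "natural n \<Longrightarrow> m \<epsilon> n \<Longrightarrow> natural m"
proof -
  assume n: "natural n"
  have "\<forall>m. m \<epsilon> n \<longrightarrow> natural m"
    using n by (induction rule: natural_induct) ((intro definability), auto)
  then show "m \<epsilon> n \<Longrightarrow> natural m" by blast
qed

lemma natural_trans:
  assumes "natural n" "m \<epsilon> n" "k \<epsilon> m" shows "k \<epsilon> n"
proof -
  have "\<forall>m k. m \<epsilon> n \<longrightarrow> k \<epsilon> m \<longrightarrow> k \<epsilon> n"
    using assms(1) by (induction rule: natural_induct) ((intro definability), auto)
  then show ?thesis using assms by blast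
qed

lemma natural_cases:
  assumes "natural n" obtains "n = emp" | m where "natural m" "n = suc m"
proof -
  have "n = emp \<or> (\<exists>m. natural m \<and> n = suc m)"
    using assms by (induction rule: natural_induct) ((intro definability), auto)
  then show ?thesis using that by blast
qed

lemma emp_mem_natural: assumes "natural n" shows "n = emp \<or> emp \<epsilon> n"
  using assms by (induction rule: natural_induct) ((intro definability), auto)

lemma suc_mem: assumes "natural n" "m \<epsilon> n" shows "suc m \<epsilon> n \<or> suc m = n"
proof -
  have "\<forall>m. m \<epsilon> n \<longrightarrow> suc m \<epsilon> n \<or> suc m = n"
    using assms(1) by (induction rule: natural_induct) ((intro definability), auto)
  then show ?thesis using assms by blast
qed

lemma natural_linear: assumes "natural m" "natural n" shows "m \<epsilon> n \<or> m = n \<or> n \<epsilon> m"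
  using assms(2)
proof (induction rule: natural_induct)
  case emp then show ?case using emp_mem_natural[OF assms(1)] by auto
next
  case (suc n) then show ?case using suc_mem[OF assms(1), of n] by auto
qed (intro definability)

lemma suc_inj [simp]: "suc m = suc n \<longleftrightarrow> m = n"
proof
  assume *: "suc m = suc n"
  have "m \<epsilon> suc m" "n \<epsilon> suc n" by simp_all
  then have "m \<epsilon> suc n" "n \<epsilon> suc m" by (simp_all only: *)
  then show "m = n" using mem_asym by auto
qed simp

lemma suc_neq_emp [simp]: "suc m \<noteq> emp" "emp \<noteq> suc m"
proof -
  have "m \<epsilon> suc m" by simp
  then show "suc m \<noteq> emp" by force
  then show "emp \<noteq> suc m" by simp
qed

text \<open>Foundation yields a membership-minimal element among the members of \<open>suc n\<close>
  that satisfy \<open>P\<close>. On naturals membership is the order, and transitivity extends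
  minimality beyond \<open>suc n\<close>.\<close>

lemma natural_least:
  assumes "D1 P" "natural n" "P n"
  obtains m where "natural m" "P m" "\<And>k. natural k \<Longrightarrow> P k \<Longrightarrow> \<not> k \<epsilon> m"
proof -
  let ?B = "sep (suc n) P"
  have "n \<epsilon> ?B" using assms by (simp add: mem_sep)
  then obtain m where m: "m \<epsilon> ?B" "\<And>k. k \<epsilon> ?B \<Longrightarrow> \<not> k \<epsilon> m"
    using foundation[rule_format, of ?B] by (auto simp: is_empty_def)
  have mn: "m \<epsilon> suc n" "P m" using m(1) assms(1) by (simp_all only: mem_sep)
  then have "natural m" using natural_mem[of "suc n"] assms(2) by simp
  moreover have "\<not> k \<epsilon> m" if "P k" for k
    using m(2)[of k] mn(1) natural_trans[of "suc n" m k] assms that by (auto simp: mem_sep)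
  ultimately show ?thesis using that mn by blast
qed

lemma equinumerous_diff:
  assumes "equinumerous A B" "a \<epsilon> A" "b \<epsilon> B"
  shows "equinumerous (diff A (upair a a)) (diff B (upair b b))"
proof -
  obtain f where f: "F1 f" "bij_betw f (elts A) (elts B)" using assms(1) by (rule equinumerousE)
  \<comment> \<open>The point that \<open>f\<close> sends to \<open>b\<close> is redirected to
    \<open>f a\<close>, the value that becomes free when \<open>a\<close> is removed.\<close>
  define g where "g x = (if f x = b then f a else f x)" for x
  have "F1 g" unfolding g_def by (intro definability F1D[OF f(1)])
  moreover have "bij_betw g (elts (diff A (upair a a))) (elts (diff B (upair b b)))"
  proof -
    have inj: "x = y" if "f x = f y" "x \<epsilon> A" "y \<epsilon> A" for x y
      using that f(2) by (auto simp: bij_betw_def inj_on_def)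
    have onto: "\<exists>x. x \<epsilon> A \<and> y = f x" if "y \<epsilon> B" for y
      using that f(2) unfolding bij_betw_def by (metis imageE mem_elts)
    have im: "f x \<epsilon> B" if "x \<epsilon> A" for x
      using that f(2) by (auto simp: bij_betw_def)
    show ?thesis unfolding bij_betw_def
    proof (intro conjI inj_onI set_eqI iffI)
      fix x y assume "x \<in> elts (diff A (upair a a))" "y \<in> elts (diff A (upair a a))" "g x = g y"
      then show "x = y" using inj[of x y] inj[of x a] inj[of y a] assms(2)
        by (auto simp: g_def split: if_splits)
    next
      fix y assume "y \<in> g ` elts (diff A (upair a a))"
      then obtain x where x: "x \<epsilon> A" "x \<noteq> a" "y = g x" by auto
      then have "y \<noteq> b" using inj[of x a] assms(2) by (auto simp: g_def)
      then show "y \<in> elts (diff B (upair b b))" using x im assms(2) by (auto simp: g_def)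
    next
      fix y assume "y \<in> elts (diff B (upair b b))"
      then have y: "y \<epsilon> B" "y \<noteq> b" by auto
      show "y \<in> g ` elts (diff A (upair a a))"
      proof (cases "y = f a")
        case True
        obtain x where "x \<epsilon> A" "b = f x" using onto assms(3) by blast
        then show ?thesis using True y by (intro image_eqI[of _ _ x]) (auto simp: g_def)
      next
        case False
        obtain x where "x \<epsilon> A" "y = f x" using onto y by blast
        then show ?thesis using False y by (intro image_eqI[of _ _ x]) (auto simp: g_def)
      qed
    qed
  qed
  ultimately show ?thesis by (rule equinumerousI)
qed

lemma equinumerous_ins:
  assumes "equinumerous A B" "\<not> a \<epsilon> A" "\<not> b \<epsilon> B"
  shows "equinumerous (ins a A) (ins b B)"
proof -
  obtain f where f: "F1 f" "bij_betw f (elts A) (elts B)" using assms(1) by (rule equinumerousE)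
  define g where "g x = (if x = a then b else f x)" for x
  have "F1 g" unfolding g_def by (intro definability F1D[OF f(1)])
  moreover have "bij_betw g (elts (ins a A)) (elts (ins b B))"
  proof -
    have "bij_betw g (elts A) (elts B) = bij_betw f (elts A) (elts B)"
      by (rule bij_betw_cong) (use assms(2) in \<open>auto simp: g_def\<close>)
    then have "bij_betw g (elts A \<union> {a}) (elts B \<union> {g a})"
      using f(2) assms by (intro notIn_Un_bij_betw) (auto simp: g_def)
    moreover have "elts (ins a A) = elts A \<union> {a}" "elts (ins b B) = elts B \<union> {g a}"
      by (auto simp: g_def)
    ultimately show ?thesis by simp
  qed
  ultimately show ?thesis by (rule equinumerousI)
qed

lemma equinumerous_emp: "equinumerous A emp \<longleftrightarrow> A = emp"
proof
  assume "equinumerous A emp"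
  then obtain f where "bij_betw f (elts A) (elts emp)" by (rule equinumerousE)
  then show "A = emp" by (intro set_ext) (auto dest: bij_betwE)
qed (simp add: equinumerous_refl)

text \<open>Removing the top elements of \<open>suc m\<close> and \<open>suc n'\<close> reduces the
  claim to \<open>m\<close> and \<open>n'\<close>; the quantifier over \<open>n\<close> inside the
  induction makes the hypothesis applicable to \<open>n'\<close>.\<close>

lemma natural_equinumerous:
  assumes "natural m" "natural n" "equinumerous m n" shows "m = n"
proof -
  have "\<forall>n. natural n \<longrightarrow> equinumerous m n \<longrightarrow> m = n"
    using assms(1)
  proof (induction rule: natural_induct)
    case emp
    show ?case
    proof (intro allI impI)
      fix n assume "equinumerous emp n"
      from equinumerous_sym[OF this] show "emp = n" by (simp add: equinumerous_emp)
    qed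
  next
    case (suc m)
    show ?case
    proof (intro allI impI)
      fix n assume n: "natural n" "equinumerous (suc m) n"
      then have "n \<noteq> emp" using equinumerous_emp[of "suc m"] by auto
      then obtain n' where n': "natural n'" "n = suc n'"
        using natural_cases[OF n(1)] by blast
      have "diff (suc k) (upair k k) = k" for k by (rule set_ext) auto
      then have "equinumerous m n'"
        using equinumerous_diff[OF n(2), of m n'] n' by simp
      then show "suc m = n" using suc n' by auto
    qed
  qed (intro definability)
  then show ?thesis using assms by blast
qed

section \<open>Finite sets and their cardinals\<close>

definition cardinal :: "'a \<Rightarrow> 'a" where "cardinal A = descr (\<lambda>m. natural m \<and> equinumerous A m)"

lemma F1_cardinal: "F1 cardinal" unfolding cardinal_def by (intro definability)
lemmas [definability] = F1_cardinal[THEN F1D]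

lemma cardinal_eqI:
  assumes "natural m" "equinumerous A m" shows "finite_set A" "cardinal A = m"
proof -
  show "finite_set A" using assms unfolding finite_set_def by blast
  show "cardinal A = m" unfolding cardinal_def
  proof (rule descr_eq)
    fix x assume "natural x \<and> equinumerous A x"
    then show "x = m"
      using natural_equinumerous[of x m] assms equinumerous_trans[OF equinumerous_sym, of A x m] by blast
  qed (use assms in blast)
qed

lemma cardinal:
  assumes "finite_set A" shows natural_cardinal: "natural (cardinal A)" and equinumerous_cardinal: "equinumerous A (cardinal A)"
proof -
  obtain m where "natural m" "equinumerous A m" using assms unfolding finite_set_def by blast
  then show "natural (cardinal A)" "equinumerous A (cardinal A)" by (simp_all add: cardinal_eqI(2))
qed

lemma equinumerous_finite:
  assumes "equinumerous A B" "finite_set A" shows "finite_set B" "cardinal B = cardinal A"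
  using cardinal_eqI[OF natural_cardinal[OF assms(2)], of B]
    equinumerous_trans[OF equinumerous_sym[OF assms(1)] equinumerous_cardinal[OF assms(2)]] by simp_all

lemma finite_natural: "natural n \<Longrightarrow> finite_set n" "natural n \<Longrightarrow> cardinal n = n"
  using cardinal_eqI equinumerous_refl by auto

lemma finite_emp [simp]: "finite_set emp" and cardinal_emp [simp]: "cardinal emp = emp"
  using finite_natural by auto

lemma finite_gt_iff: "finite_gt n x \<longleftrightarrow> finite_set x \<and> n \<epsilon> cardinal x"
  unfolding finite_gt_def using cardinal cardinal_eqI by (metis)

lemma equinumerous_natural_iff: "natural n \<Longrightarrow> equinumerous x n \<longleftrightarrow> finite_set x \<and> cardinal x = n"
  using cardinal cardinal_eqI by metis

lemma finite_ins_cardinal: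
  assumes "finite_set A" "\<not> a \<epsilon> A" shows "finite_set (ins a A)" "cardinal (ins a A) = suc (cardinal A)"
  using cardinal_eqI[of "suc (cardinal A)" "ins a A"] equinumerous_ins[OF equinumerous_cardinal[OF assms(1)] assms(2), of "cardinal A"]
    natural_cardinal[OF assms(1)] by (simp_all add: suc_def[symmetric])

lemma ins_absorb: "a \<epsilon> A \<Longrightarrow> ins a A = A" by (rule set_ext) auto

lemma finite_ins [simp]: "finite_set A \<Longrightarrow> finite_set (ins a A)"
  using finite_ins_cardinal(1) ins_absorb by metis

lemma finite_set_induct [consumes 1, case_names def emp ins]:
  assumes "finite_set A" and D: "D1 P" and 0: "P emp"
    and I: "\<And>A a. finite_set A \<Longrightarrow> \<not> a \<epsilon> A \<Longrightarrow> P A \<Longrightarrow> P (ins a A)"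
  shows "P A"
proof -
  have "\<forall>A. finite_set A \<longrightarrow> cardinal A = m \<longrightarrow> P A" if "natural m" for m
    using that
  proof (induction rule: natural_induct)
    case def show ?case by (intro definability D1D[OF D])
  next
    case emp show ?case using 0 equinumerous_cardinal equinumerous_emp by metis
  next
    case (suc m)
    show ?case
    proof (intro allI impI)
      fix A assume A: "finite_set A" "cardinal A = suc m"
      then have "A \<noteq> emp" by auto
      then obtain a where a: "a \<epsilon> A" using is_empty_iff is_empty_def by auto
      let ?B = "diff A (upair a a)"
      have "diff (suc m) (upair m m) = m" by (rule set_ext) auto
      then have "equinumerous ?B m"
        using equinumerous_diff[OF equinumerous_cardinal[OF A(1)] a, of m] A by simp
      then have "finite_set ?B" "cardinal ?B = m" using cardinal_eqI suc by auto
      then have "P (ins a ?B)" using suc I[of ?B a] by auto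
      moreover have "ins a ?B = A" using a by (intro set_ext) auto
      ultimately show "P A" by simp
    qed
  qed
  then show ?thesis using assms(1) natural_cardinal by blast
qed

lemma subset_of_ins: "\<not> a \<epsilon> B \<Longrightarrow> subset_of B (ins a A) \<Longrightarrow> subset_of B A"
  by (auto simp: subset_of_def)

text \<open>Finiteness and the strict drop for proper subsets are proved together, since the step
  removes a point from \<open>B\<close> and needs both for the remainder.\<close>

lemma finite_subset_cardinal:
  assumes "finite_set A" "subset_of B A"
  shows "finite_set B \<and> (B = A \<or> cardinal B \<epsilon> cardinal A)"
proof -
  have "\<forall>B. subset_of B A \<longrightarrow> finite_set B \<and> (B = A \<or> cardinal B \<epsilon> cardinal A)"
    using assms(1)
  proof (induction rule: finite_set_induct)
    case emp
    have "subset_of B emp \<Longrightarrow> B = emp" for B by (auto simp: subset_of_def intro: set_ext)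
    then show ?case by (metis finite_emp)
  next
    case (ins A a)
    note [simp] = finite_ins_cardinal[OF ins(1,2)] natural_cardinal[OF ins(1)]
    show ?case
    proof (intro allI impI)
      fix B assume B: "subset_of B (ins a A)"
      show "finite_set B \<and> (B = ins a A \<or> cardinal B \<epsilon> cardinal (ins a A))"
      proof (cases "a \<epsilon> B")
        case False
        then show ?thesis using ins(3) subset_of_ins[OF False B] by auto
      next
        case True
        let ?B = "diff B (upair a a)"
        have eq: "ins a ?B = B" using True by (intro set_ext) auto
        have "subset_of ?B A" using B by (auto simp: subset_of_def)
        then have f: "finite_set ?B" "?B = A \<or> cardinal ?B \<epsilon> cardinal A" using ins(3) by auto
        have "finite_set B" "cardinal B = suc (cardinal ?B)" using finite_ins_cardinal[OF f(1), of a] eq by auto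
        then show ?thesis using f natural_cardinal[OF f(1)] eq suc_mem[OF natural_cardinal[OF ins(1)]] by auto
      qed
    qed
  qed (intro definability)
  then show ?thesis using assms by blast
qed

lemma finite_set_subset: "finite_set A \<Longrightarrow> subset_of B A \<Longrightarrow> finite_set B"
  using finite_subset_cardinal by blast

lemma finite_cup: assumes "finite_set A" "finite_set B" shows "finite_set (cup A B)"
  using assms(1)
proof (induction rule: finite_set_induct)
  case emp
  have "cup emp B = B" by (rule set_ext) auto
  then show ?case using assms(2) by simp
next
  case (ins A a)
  have "cup (ins a A) B = ins a (cup A B)" by (rule set_ext) auto
  then show ?case using ins by simp
qed (intro definability)

lemma cardinal_eq_emp: "finite_set A \<Longrightarrow> cardinal A = emp \<Longrightarrow> A = emp"
  using equinumerous_cardinal[of A] equinumerous_emp by simp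

text \<open>The sets \<open>g i\<close> are values of a definable map on the universe, so their
  union is cut out of an ambient set \<open>S\<close>. One more index adds one more finite
  set.\<close>

lemma finite_set_UN:
  assumes g: "F1 g" and "finite_set I" "\<And>i. i \<epsilon> I \<Longrightarrow> finite_set (g i)"
  shows "finite_set (sep S (\<lambda>z. \<exists>i. i \<epsilon> I \<and> z \<epsilon> g i))"
proof -
  note [definability] = F1D[OF g]
  have D: "D1 (\<lambda>z. \<exists>i. i \<epsilon> I \<and> z \<epsilon> g i)" for I by (intro definability)
  have "(\<forall>i. i \<epsilon> I \<longrightarrow> finite_set (g i)) \<longrightarrow> finite_set (sep S (\<lambda>z. \<exists>i. i \<epsilon> I \<and> z \<epsilon> g i))"
    using assms(2)
  proof (induction rule: finite_set_induct)
    case emp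
    have "sep S (\<lambda>z. \<exists>i. i \<epsilon> emp \<and> z \<epsilon> g i) = emp" by (rule set_ext) (simp only: mem_sep[OF D], simp)
    then show ?case by simp
  next
    case (ins I a)
    have "subset_of (sep S (\<lambda>z. \<exists>i. i \<epsilon> ins a I \<and> z \<epsilon> g i))
       (cup (g a) (sep S (\<lambda>z. \<exists>i. i \<epsilon> I \<and> z \<epsilon> g i)))"
      unfolding subset_of_def mem_cup mem_sep[OF D] by auto
    then show ?case using ins by (auto intro: finite_set_subset finite_cup)
  qed (intro definability)
  then show ?thesis using assms(3) by blast
qed

text \<open>Otherwise \<open>I\<close> would be a finite union of finite fibres of
  \<open>h\<close>.\<close>

lemma pigeonhole:
  assumes h: "F1 h" and "\<not> finite_set I" "finite_set E" "\<And>i. i \<epsilon> I \<Longrightarrow> h i \<epsilon> E"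
  obtains e where "e \<epsilon> E" "\<not> finite_set (sep I (\<lambda>i. h i = e))"
proof (rule ccontr)
  note [definability] = F1D[OF h]
  assume "\<not> thesis"
  then have *: "\<And>e. e \<epsilon> E \<Longrightarrow> finite_set (sep I (\<lambda>i. h i = e))" using that by blast
  have D: "D1 (\<lambda>i. h i = e)" for e by (intro definability)
  have g: "F1 (\<lambda>e. sep I (\<lambda>i. h i = e))" by (intro definability)
  have "finite_set (sep I (\<lambda>z. \<exists>e. e \<epsilon> E \<and> z \<epsilon> sep I (\<lambda>i. h i = e)))"
    by (rule finite_set_UN[OF g assms(3) *])
  moreover have "sep I (\<lambda>z. \<exists>e. e \<epsilon> E \<and> z \<epsilon> sep I (\<lambda>i. h i = e)) = I"
    using assms(4) by (intro set_ext, subst mem_sep) (intro definability, auto simp: mem_sep[OF D])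
  ultimately show False using assms(2) by simp
qed

end

section \<open>Arithmetic of the natural numbers\<close>

context ZF_model
begin

definition one :: 'a where "one = suc emp"

lemma natural_one [simp]: "natural one" and one_neq_emp [simp]: "one \<noteq> emp"
  by (simp_all add: one_def)

lemma is_one_iff: "is_one x \<longleftrightarrow> x = one"
  by (auto simp: is_one_def is_empty_iff is_succ_iff one_def suc_def)

text \<open>Sums and products of naturals are taken as cardinals of sets, in accordance with
  \<open>is_times\<close>; the tags \<open>emp\<close> and \<open>one\<close> keep the summands
  apart. The recursion equations follow from the effect of enlarging one argument by
  \<open>suc\<close>.\<close>

definition disjoint_sum :: "'a \<Rightarrow> 'a \<Rightarrow> 'a" where
  "disjoint_sum A B = cup (product A (upair emp emp)) (product B (upair one one))"
definition add :: "'a \<Rightarrow> 'a \<Rightarrow> 'a" where "add a b = cardinal (disjoint_sum a b)"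
definition mult :: "'a \<Rightarrow> 'a \<Rightarrow> 'a" where "mult a b = cardinal (product a b)"

lemma F2_add: "F2 add" unfolding add_def disjoint_sum_def by (intro definability)
lemma F2_mult: "F2 mult" unfolding mult_def by (intro definability)
lemmas [definability] = F2_add[THEN F2D] F2_mult[THEN F2D]

lemma equinumerous_product_singleton: "equinumerous A (product A (upair c c))"
proof (rule equinumerousI)
  show "F1 (\<lambda>a. pair a c)" by (intro definability)
  show "bij_betw (\<lambda>a. pair a c) (elts A) (elts (product A (upair c c)))"
    by (auto simp: bij_betw_def inj_on_def mem_product)
qed

lemma add_emp [simp]: assumes "natural x" shows "add x emp = x"
proof -
  have "disjoint_sum x emp = product x (upair emp emp)"
    by (rule set_ext) (auto simp: disjoint_sum_def mem_product)
  then show ?thesis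
    using equinumerous_finite(2)[OF equinumerous_product_singleton] finite_natural[OF assms]
    by (simp add: add_def)
qed

lemma disjoint_sum_suc: "disjoint_sum x (suc y) = ins (pair y one) (disjoint_sum x y)"
  by (rule set_ext) (auto simp: disjoint_sum_def mem_product)

lemma finite_disjoint_sum: assumes "natural x" "natural y" shows "finite_set (disjoint_sum x y)"
  using assms(2)
proof (induction rule: natural_induct)
  case def show ?case unfolding disjoint_sum_def by (intro definability)
next
  case emp
  have "disjoint_sum x emp = product x (upair emp emp)"
    by (rule set_ext) (auto simp: disjoint_sum_def mem_product)
  then show ?case
    using equinumerous_finite(1)[OF equinumerous_product_singleton] finite_natural[OF assms(1)] by simp
qed (simp add: disjoint_sum_suc)

lemma natural_add [simp]: "natural x \<Longrightarrow> natural y \<Longrightarrow> natural (add x y)"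
  by (simp add: add_def natural_cardinal finite_disjoint_sum)

lemma add_suc [simp]:
  assumes "natural x" "natural y" shows "add x (suc y) = suc (add x y)"
proof -
  have "\<not> pair y one \<epsilon> disjoint_sum x y" by (auto simp: disjoint_sum_def mem_product)
  then show ?thesis using finite_ins_cardinal(2)[OF finite_disjoint_sum[OF assms]]
    by (simp add: add_def disjoint_sum_suc)
qed

lemma cardinal_cup:
  assumes "finite_set A" "finite_set B" "\<And>x. x \<epsilon> A \<Longrightarrow> \<not> x \<epsilon> B"
  shows "cardinal (cup A B) = add (cardinal A) (cardinal B)"
proof -
  have "(\<forall>x. x \<epsilon> A \<longrightarrow> \<not> x \<epsilon> B) \<longrightarrow> cardinal (cup A B) = add (cardinal A) (cardinal B)"
    using assms(2)
  proof (induction rule: finite_set_induct)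
    case emp
    have "cup A emp = A" by (rule set_ext) auto
    then show ?case using assms(1) by (simp add: natural_cardinal)
  next
    case (ins B b)
    show ?case
    proof
      assume *: "\<forall>x. x \<epsilon> A \<longrightarrow> \<not> x \<epsilon> ins b B"
      have eq: "cup A (ins b B) = ins b (cup A B)" by (rule set_ext) auto
      have "\<not> b \<epsilon> cup A B" using * ins(2) by auto
      from finite_ins_cardinal(2)[OF finite_cup[OF assms(1) ins(1)] this]
      show "cardinal (cup A (ins b B)) = add (cardinal A) (cardinal (ins b B))"
        using * ins assms(1) by (auto simp: eq finite_ins_cardinal(2)[OF ins(1,2)] natural_cardinal)
    qed
  qed (intro definability)
  then show ?thesis using assms(3) by blast
qed

lemma product_suc: "product x (suc y) = cup (product x y) (product x (upair y y))"
  by (rule set_ext) (auto simp: mem_product)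

lemma finite_product: assumes "natural x" "natural y" shows "finite_set (product x y)"
  using assms(2)
proof (induction rule: natural_induct)
  case emp
  have "product x emp = emp" by (rule set_ext) (auto simp: mem_product)
  then show ?case by simp
next
  case (suc y)
  show ?case unfolding product_suc
    by (rule finite_cup[OF suc(2) equinumerous_finite(1)[OF equinumerous_product_singleton]])
      (rule finite_natural[OF assms(1)])
qed (intro definability)

lemma natural_mult [simp]: "natural x \<Longrightarrow> natural y \<Longrightarrow> natural (mult x y)"
  by (simp add: mult_def natural_cardinal finite_product)

lemma mult_emp [simp]: "mult x emp = emp"
proof -
  have "product x emp = emp" by (rule set_ext) (auto simp: mem_product)
  then show ?thesis by (simp add: mult_def)
qed

lemma mult_suc [simp]:
  assumes "natural x" "natural y" shows "mult x (suc y) = add (mult x y) x"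
proof -
  note f = equinumerous_finite[OF equinumerous_product_singleton finite_natural(1)[OF assms(1)], of y]
  have "cardinal (cup (product x y) (product x (upair y y))) = add (cardinal (product x y)) (cardinal (product x (upair y y)))"
    by (rule cardinal_cup[OF finite_product[OF assms] f(1)]) (auto simp: mem_product)
  then show ?thesis using f(2) finite_natural(2)[OF assms(1)] by (simp add: mult_def product_suc)
qed

lemma add_emp_left [simp]: assumes "natural x" shows "add emp x = x"
  using assms by (induction rule: natural_induct) ((intro definability), simp_all)

lemma add_suc_left [simp]:
  assumes "natural x" "natural y" shows "add (suc x) y = suc (add x y)"
  using assms(2,1) by (induction rule: natural_induct) ((intro definability), simp_all)

lemma add_commute: assumes "natural x" "natural y" shows "add x y = add y x"
  using assms(2,1) by (induction rule: natural_induct) ((intro definability), simp_all)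

lemma add_assoc:
  assumes "natural x" "natural y" "natural z" shows "add (add x y) z = add x (add y z)"
  using assms(3,1,2) by (induction rule: natural_induct) ((intro definability), simp_all)

lemma add_left_commute:
  assumes "natural x" "natural y" "natural z" shows "add x (add y z) = add y (add x z)"
  using assms by (simp add: add_commute[of x y] flip: add_assoc)

lemmas add_ac = add_assoc add_commute add_left_commute

lemma mult_emp_left [simp]: assumes "natural x" shows "mult emp x = emp"
  using assms by (induction rule: natural_induct) ((intro definability), simp_all)

lemma mult_suc_left [simp]:
  assumes "natural x" "natural y" shows "mult (suc x) y = add (mult x y) y"
  using assms(2,1) by (induction rule: natural_induct) ((intro definability), simp_all add: add_ac)

lemma mult_commute: assumes "natural x" "natural y" shows "mult x y = mult y x"
  using assms(2,1) by (induction rule: natural_induct) ((intro definability), simp_all)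

lemma mult_add:
  assumes "natural x" "natural y" "natural z" shows "mult x (add y z) = add (mult x y) (mult x z)"
  using assms(3,1,2) by (induction rule: natural_induct) ((intro definability), simp_all add: add_ac)

lemma mult_assoc:
  assumes "natural x" "natural y" "natural z" shows "mult (mult x y) z = mult x (mult y z)"
  using assms(3,1,2) by (induction rule: natural_induct) ((intro definability), simp_all add: mult_add)

lemma mult_one [simp]: "natural x \<Longrightarrow> mult x one = x" "natural x \<Longrightarrow> mult one x = x"
  by (simp_all add: one_def)

lemma add_eq_emp: "natural x \<Longrightarrow> natural y \<Longrightarrow> add x y = emp \<Longrightarrow> y = emp"
  by (erule natural_cases[of y]) auto

lemma mult_eq_emp: "natural x \<Longrightarrow> natural y \<Longrightarrow> mult x y = emp \<Longrightarrow> x = emp \<or> y = emp"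
  by (rule natural_cases[of x], assumption, simp, rule natural_cases[of y]) auto

lemma add_cancel:
  assumes "natural x" "natural y" "natural z" "add x y = add x z" shows "y = z"
proof -
  have "add x y = add x z \<longrightarrow> y = z"
    using assms(1-3) by (induction rule: natural_induct) ((intro definability), simp_all)
  then show ?thesis using assms(4) by blast
qed

lemma mem_add_suc: assumes "natural x" "natural y" shows "x \<epsilon> add x (suc y)"
  using assms(2,1) by (induction rule: natural_induct) ((intro definability), simp_all)

text \<open>This decomposition replaces subtraction; the summand \<open>suc c\<close> records that
  the difference is positive.\<close>

lemma mem_imp_add:
  assumes "natural n" "m \<epsilon> n" obtains c where "natural c" "n = add m (suc c)"
proof -
  have "m \<epsilon> n \<longrightarrow> (\<exists>c. natural c \<and> n = add m (suc c))"
    using assms(1)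
  proof (induction rule: natural_induct)
    case (suc n)
    show ?case
    proof
      assume "m \<epsilon> suc n"
      then consider "m = n" | "m \<epsilon> n" by auto
      then show "\<exists>c. natural c \<and> suc n = add m (suc c)"
      proof cases
        case 1
        then show ?thesis using suc by (intro exI[of _ emp]) simp
      next
        case 2
        then obtain c where c: "natural c" "n = add m (suc c)" using suc by blast
        then show ?thesis using natural_mem[OF suc(1) 2] by (intro exI[of _ "suc c"]) simp
      qed
    qed
  qed ((intro definability), simp)
  then show ?thesis using that assms by blast
qed

lemma mult_mem_mono:
  assumes "natural a" "a \<noteq> emp" "natural c" "b \<epsilon> c" shows "mult a b \<epsilon> mult a c"
proof -
  obtain d where d: "natural d" "c = add b (suc d)" using mem_imp_add assms by metis
  have b: "natural b" using natural_mem assms by blast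
  have "mult a (suc d) \<noteq> emp" using mult_eq_emp[of a "suc d"] assms d by auto
  then obtain e where e: "natural e" "mult a (suc d) = suc e"
    using natural_cases[of "mult a (suc d)"] assms d natural_mult natural_suc by metis
  have "mult a c = add (mult a b) (suc e)"
    unfolding d(2) e(2)[symmetric] using assms b d by (intro mult_add) auto
  then show ?thesis using mem_add_suc[of "mult a b" e] assms b e by simp
qed

lemma mult_cancel:
  assumes "natural a" "a \<noteq> emp" "natural b" "natural c" "mult a b = mult a c" shows "b = c"
  using natural_linear[OF assms(3,4)] mult_mem_mono[OF assms(1,2,3), of c]
    mult_mem_mono[OF assms(1,2,4), of b] assms(5) by auto

section \<open>Divisibility and prime numbers\<close>

definition divides :: "'a \<Rightarrow> 'a \<Rightarrow> bool" where
  "divides d n \<longleftrightarrow> (\<exists>q. natural q \<and> n = mult d q)"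

lemma D2_divides: "D2 divides" unfolding divides_def by (intro definability)
lemmas [definability] = D2_divides[THEN D2D]

lemma dividesE: assumes "divides d n" obtains q where "natural q" "n = mult d q"
  using assms unfolding divides_def by blast

lemma dividesI: "natural q \<Longrightarrow> divides d (mult d q)" unfolding divides_def by blast

lemma divides_emp [simp]: "divides d emp"
  using dividesI[of emp d] by simp

lemma divides_one [simp]: "natural n \<Longrightarrow> divides one n"
  using dividesI[of n one] by simp

lemma divides_refl: "natural n \<Longrightarrow> divides n n"
  using dividesI[of one n] by simp

lemma divides_trans: assumes "natural a" "divides a b" "divides b c" shows "divides a c"
proof -
  obtain q r where "natural q" "b = mult a q" "natural r" "c = mult b r" using assms dividesE by metis
  then show ?thesis using dividesI[of "mult q r" a] assms(1) by (simp add: mult_assoc)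
qed

lemma divides_add: assumes "natural d" "divides d a" "divides d b" shows "divides d (add a b)"
proof -
  obtain q r where "natural q" "a = mult d q" "natural r" "b = mult d r" using assms dividesE by metis
  then show ?thesis using dividesI[of "add q r" d] assms(1) by (simp add: mult_add)
qed

text \<open>The quotients \<open>u\<close> and \<open>v\<close> are compared: if \<open>u\<close> is
  larger, the difference is the quotient of \<open>b\<close>; in the other two cases
  \<open>b\<close> is zero.\<close>

lemma divides_add_cancel:
  assumes "natural d" "natural b" "divides d (add a b)" "divides d a" shows "divides d b"
proof -
  obtain u where u: "natural u" "add a b = mult d u" using assms(3) by (rule dividesE)
  obtain v where v: "natural v" "a = mult d v" using assms(4) by (rule dividesE)
  have eq: "add (mult d v) b = mult d u" using u v by simp
  consider "u = v" | w where "natural w" "u = add v (suc w)" | w where "natural w" "v = add u (suc w)"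
    using natural_linear[OF u(1) v(1)] mem_imp_add[OF u(1), of v] mem_imp_add[OF v(1), of u] by metis
  then show ?thesis
  proof cases
    case 1
    then have "add (mult d v) b = add (mult d v) emp" using eq assms u v by simp
    then have "b = emp" using add_cancel[of "mult d v" b emp] assms v by simp
    then show ?thesis by simp
  next
    case (2 w)
    then have "add (mult d v) b = add (mult d v) (mult d (suc w))"
      using eq v mult_add[of d v "suc w"] assms by simp
    then have "b = mult d (suc w)"
      using add_cancel[of "mult d v" b "mult d (suc w)"] assms v 2 by simp
    then show ?thesis using dividesI[of "suc w" d] 2 by simp
  next
    case (3 w)
    have "mult d v = add (mult d u) (mult d (suc w))"
      unfolding 3(2) using assms u 3 by (intro mult_add) auto
    then have "add (mult d u) (add (mult d (suc w)) b) = add (mult d u) emp"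
      using eq assms u 3(1) add_assoc[of "mult d u" "mult d (suc w)" b] by simp
    then have "add (mult d (suc w)) b = emp"
      using add_cancel[of "mult d u" "add (mult d (suc w)) b" emp] assms u 3(1)
      by (metis natural_add natural_mult natural_suc natural_emp)
    then have "b = emp" using add_eq_emp[of "mult d (suc w)" b] assms 3(1)
      by (metis natural_mult natural_suc)
    then show ?thesis by simp
  qed
qed

lemma divides_le:
  assumes "natural d" "n \<noteq> emp" "divides d n" shows "d = n \<or> d \<epsilon> n"
proof -
  obtain q where q: "natural q" "n = mult d q" using assms(3) by (rule dividesE)
  then have "q \<noteq> emp" using assms(2) by auto
  then obtain r where r: "natural r" "q = suc r" using natural_cases[OF q(1)] by blast
  then have n: "n = add d (mult d r)" using q assms(1) add_commute[of "mult d r" d] by simp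
  show ?thesis
  proof (rule natural_cases[of "mult d r"])
    assume "mult d r = emp" then show ?thesis using n assms by simp
  next
    fix m assume "natural m" "mult d r = suc m"
    then show ?thesis using n mem_add_suc[of d m] assms by auto
  qed (use assms r in simp)
qed

lemma division:
  assumes "natural x" "natural m" "m \<noteq> emp"
  obtains q r where "natural q" "r \<epsilon> m" "x = add (mult m q) r"
proof -
  have "\<exists>q r. natural q \<and> r \<epsilon> m \<and> x = add (mult m q) r"
    using assms(1)
  proof (induction rule: natural_induct)
    case emp
    then show ?case using emp_mem_natural[OF assms(2)] assms(3)
      by (intro exI[of _ emp]) simp
  next
    case (suc x)
    then obtain q r where q: "natural q" "r \<epsilon> m" "x = add (mult m q) r" by blast
    have r: "natural r" using natural_mem q assms by blast
    consider "suc r \<epsilon> m" | "suc r = m" using suc_mem q assms by blast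
    then show ?case
    proof cases
      case 1
      then show ?thesis using q r assms by (intro exI[of _ q] exI[of _ "suc r"]) simp
    next
      case 2
      have "suc x = add (mult m q) (suc r)" using q r assms by simp
      then have "suc x = mult m (suc q)" using 2 q(1) assms(2) by simp
      then show ?thesis using q(1) assms emp_mem_natural[OF assms(2)]
        by (intro exI[of _ "suc q"] exI[of _ emp]) simp
    qed
  qed (intro definability)
  then show ?thesis using that by blast
qed

lemma prime_numberD:
  assumes "prime_number p"
  shows "natural p" "p \<noteq> emp" "p \<noteq> one"
    "\<And>a b. natural a \<Longrightarrow> natural b \<Longrightarrow> p = mult a b \<Longrightarrow> a = one \<or> b = one"
proof -
  show "natural p" "p \<noteq> emp" "p \<noteq> one"
    using assms by (auto simp: prime_number_def is_empty_iff is_one_iff)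
  fix a b assume ab: "natural a" "natural b" "p = mult a b"
  then have "is_times a b p"
    using equinumerous_cardinal[OF finite_product[OF ab(1,2)]] \<open>natural p\<close>
    by (simp add: is_times_def is_product_iff mult_def)
  then show "a = one \<or> b = one"
    using assms ab(1,2) unfolding prime_number_def is_one_iff by blast
qed

text \<open>Take the least positive \<open>m\<close> with \<open>p\<close> dividing
  \<open>mult m b\<close>. By division with remainder \<open>m\<close> divides every
  \<open>x\<close> such that \<open>p\<close> divides \<open>mult x b\<close>, in particular
  \<open>p\<close> and \<open>a\<close>. Primality leaves \<open>m = one\<close>, so that
  \<open>p\<close> divides \<open>b\<close>, or \<open>m = p\<close>, so that \<open>p\<close>
  divides \<open>a\<close>.\<close>

lemma prime_divides_mult:
  assumes "prime_number p" "natural a" "natural b" "divides p (mult a b)"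
  shows "divides p a \<or> divides p b"
proof -
  note p = prime_numberD[OF assms(1)]
  let ?P = "\<lambda>x. natural x \<and> x \<noteq> emp \<and> divides p (mult x b)"
  have D: "D1 ?P" by (intro definability)
  have "?P p" using p dividesI[OF assms(3)] by blast
  then obtain m where "natural m" and m: "?P m" "\<And>k. natural k \<Longrightarrow> ?P k \<Longrightarrow> \<not> k \<epsilon> m"
    by (rule natural_least[OF D p(1)]) (rule that)
  have dvm: "divides m x" if x: "natural x" "divides p (mult x b)" for x
  proof -
    obtain q r where q: "natural q" "r \<epsilon> m" "x = add (mult m q) r"
      using division[of x m] x m by blast
    have r: "natural r" using natural_mem q m by blast
    have "mult x b = mult b (add (mult m q) r)"
      using mult_commute[OF x(1) assms(3)] q(3) by simp
    also have "\<dots> = add (mult b (mult m q)) (mult b r)"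
      using m q(1) r assms(3) by (simp add: mult_add)
    also have "mult b (mult m q) = mult (mult m b) q"
      using mult_assoc[of b m q] mult_commute[of b m] m q(1) assms(3) by simp
    also have "mult b r = mult r b" by (rule mult_commute[OF assms(3) r])
    finally have "mult x b = add (mult (mult m b) q) (mult r b)" .
    moreover have "divides p (mult (mult m b) q)"
      using divides_trans[OF p(1), of "mult m b"] m dividesI q by blast
    ultimately have "divides p (mult r b)"
      using divides_add_cancel[of p "mult r b"] x(2) p r assms(3) by simp
    then have "r = emp" using m(2) r q by blast
    then show ?thesis using q m dividesI by simp
  qed
  obtain q where q: "natural q" "p = mult m q" using dvm[OF p(1) dividesI[OF assms(3)]] by (rule dividesE)
  then consider "m = one" | "q = one" using p(4) m by blast
  then show ?thesis
  proof cases
    case 1 then show ?thesis using m assms by simp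
  next
    case 2 then show ?thesis using dvm[OF assms(2,4)] q m by simp
  qed
qed

definition divisor_chain :: "'a \<Rightarrow> bool" where
  "divisor_chain n \<longleftrightarrow> (\<forall>d e. natural d \<and> natural e \<and> divides d n \<and> divides e n \<longrightarrow> divides d e \<or> divides e d)"

lemma D1_divisor_chain: "D1 divisor_chain" unfolding divisor_chain_def by (intro definability)
lemmas [definability] = D1_divisor_chain[THEN D1D]

lemma divisors_one: assumes "natural d" "divides d one" shows "d = one"
proof -
  have "d \<noteq> emp" using assms(2) by (auto elim!: dividesE)
  moreover have "d = one \<or> d \<epsilon> one" using divides_le[OF assms(1) _ assms(2)] by simp
  ultimately show ?thesis by (auto simp: one_def)
qed

text \<open>If \<open>mult d e = mult n p\<close>, then \<open>p\<close> divides \<open>d\<close> or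
  \<open>e\<close>; in the latter case cancelling \<open>p\<close> shows that \<open>d\<close>
  already divides \<open>n\<close>. Two divisors that are multiples of \<open>p\<close> compare as
  their cofactors, which divide \<open>n\<close>. The claim on single divisors is kept alongside the
  chain because the next step relies on it.\<close>

lemma prime_chain_step:
  assumes p: "prime_number p" and n: "natural n" "divisor_chain n"
    and d: "\<And>d. natural d \<Longrightarrow> divides d n \<Longrightarrow> d = one \<or> divides p d"
  shows "\<And>d. natural d \<Longrightarrow> divides d (mult n p) \<Longrightarrow> d = one \<or> divides p d" and "divisor_chain (mult n p)"
proof -
  note pp = prime_numberD[OF p]
  have cancel: "divides d n" if d: "natural d" "divides (mult p d) (mult n p)" for d
  proof -
    obtain e where e: "natural e" "mult n p = mult (mult p d) e" using d(2) by (rule dividesE)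
    then have "mult p n = mult p (mult d e)"
      using n d pp by (simp add: mult_assoc mult_commute[of n])
    then have "n = mult d e" using mult_cancel[of p n "mult d e"] n d e pp by simp
    then show ?thesis using dividesI e by blast
  qed
  show *: "d = one \<or> divides p d" if d': "natural d" "divides d (mult n p)" for d
  proof -
    obtain e where e: "natural e" "mult n p = mult d e" using d'(2) by (rule dividesE)
    have "divides p (mult d e)" unfolding e(2)[symmetric] mult_commute[OF n(1) pp(1)] by (rule dividesI[OF n(1)])
    then consider "divides p d" | "divides p e" using prime_divides_mult p d' e by blast
    then show ?thesis
    proof cases
      case 2
      then obtain c where c: "natural c" "e = mult p c" by (rule dividesE)
      then have "mult n p = mult (mult p d) c"
        using e d' pp by (simp add: mult_commute[of p d] mult_assoc)
      then have "divides d n" using cancel d' dividesI c by metis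
      then show ?thesis using d d' by blast
    qed blast
  qed
  show "divisor_chain (mult n p)" unfolding divisor_chain_def
  proof (intro allI impI)
    fix a b assume ab: "natural a \<and> natural b \<and> divides a (mult n p) \<and> divides b (mult n p)"
    then consider "a = one" | "b = one" | "divides p a" "divides p b" using * by blast
    then show "divides a b \<or> divides b a"
    proof cases
      case 3
      obtain a' where a': "natural a'" "a = mult p a'" using 3(1) by (rule dividesE)
      obtain b' where b': "natural b'" "b = mult p b'" using 3(2) by (rule dividesE)
      have mono: "divides (mult p x) (mult p y)" if xy: "divides x y" "natural x" for x y
      proof -
        obtain q where "natural q" "y = mult x q" using xy(1) by (rule dividesE)
        then show ?thesis using dividesI[of q "mult p x"] xy(2) pp by (simp add: mult_assoc)
      qed
      have "divides a' n" "divides b' n" using cancel ab a' b' by blast+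
      then show ?thesis using n(2) a' b' mono unfolding divisor_chain_def by blast
    qed (use ab in auto)
  qed
qed

text \<open>Serves two purposes: with an evaluation map as \<open>h\<close> it counts functions, and
  with \<open>fst_of\<close> it counts unions of pieces over members of the family.\<close>

lemma cardinal_fibres:
  assumes h: "F1 h" and "finite_set E" "natural m"
    and "\<And>e. e \<epsilon> E \<Longrightarrow> finite_set (sep Z (\<lambda>z. h z = e)) \<and> cardinal (sep Z (\<lambda>z. h z = e)) = m"
  shows "finite_set (sep Z (\<lambda>z. h z \<epsilon> E)) \<and> cardinal (sep Z (\<lambda>z. h z \<epsilon> E)) = mult m (cardinal E)"
proof -
  note [definability] = F1D[OF h]
  have D: "D1 (\<lambda>z. h z \<epsilon> E)" "D1 (\<lambda>z. h z = e)" for E e by (intro definability)+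
  have "(\<forall>e. e \<epsilon> E \<longrightarrow> finite_set (sep Z (\<lambda>z. h z = e)) \<and> cardinal (sep Z (\<lambda>z. h z = e)) = m) \<longrightarrow>
    finite_set (sep Z (\<lambda>z. h z \<epsilon> E)) \<and> cardinal (sep Z (\<lambda>z. h z \<epsilon> E)) = mult m (cardinal E)"
    (is "?A E \<longrightarrow> ?B E")
    using assms(2)
  proof (induction rule: finite_set_induct)
    case def show ?case by (intro definability)
  next
    case emp
    have "sep Z (\<lambda>z. h z \<epsilon> emp) = emp" by (rule set_ext) (simp only: mem_sep[OF D(1)], simp)
    then show ?case by simp
  next
    case (ins E e)
    show ?case
    proof
      assume *: "?A (ins e E)"
      then have IH: "?B E" using ins(3) by simp
      have e: "finite_set (sep Z (\<lambda>z. h z = e))" "cardinal (sep Z (\<lambda>z. h z = e)) = m" using * by simp_all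
      have eq: "sep Z (\<lambda>z. h z \<epsilon> ins e E) = cup (sep Z (\<lambda>z. h z \<epsilon> E)) (sep Z (\<lambda>z. h z = e))"
        by (rule set_ext, unfold mem_cup mem_sep[OF D(1)] mem_sep[OF D(2)]) auto
      have "cardinal (sep Z (\<lambda>z. h z \<epsilon> ins e E)) = add (mult m (cardinal E)) m"
        unfolding eq using IH e ins(2)
        by (subst cardinal_cup) (auto simp: mem_sep[OF D(1)] mem_sep[OF D(2)])
      then show "?B (ins e E)"
        using finite_cup[of "sep Z (\<lambda>z. h z \<epsilon> E)" "sep Z (\<lambda>z. h z = e)"] IH e
          natural_cardinal[OF ins(1)] assms(3) finite_ins_cardinal(2)[OF ins(1,2)]
        unfolding eq by simp
    qed
  qed
  then show ?thesis using assms(4) by blast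
qed

section \<open>Function sets and prime powers\<close>

definition funcs :: "'a \<Rightarrow> 'a \<Rightarrow> 'a" where
  "funcs A B = sep (Power (product A B)) (\<lambda>f. is_function f A B)"

lemma F2_funcs: "F2 funcs" unfolding funcs_def by (intro definability)
lemmas [definability] = F2_funcs[THEN F2D]

lemma mem_funcs [simp]: "f \<epsilon> funcs A B \<longleftrightarrow> is_function f A B"
proof -
  have "is_function f A B \<Longrightarrow> subset_of f (product A B)"
    by (auto simp: is_function_def subset_of_def is_pair_iff mem_product) 
  then show ?thesis unfolding funcs_def by (subst mem_sep) (intro definability, auto)
qed

lemma is_function_space_iff: "is_function_space A B s \<longleftrightarrow> s = funcs A B"
  by (auto simp: is_function_space_def intro: set_ext)

lemma funcs_emp: "funcs emp B = one"
proof -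
  have "is_function f emp B \<longleftrightarrow> f = emp" for f
    by (auto simp: is_function_def intro: set_ext)
  then show ?thesis by (intro set_ext) (simp add: one_def)
qed

lemma is_function_iff:
  "is_function f A B \<longleftrightarrow> (\<forall>z. z \<epsilon> f \<longrightarrow> (\<exists>a b. a \<epsilon> A \<and> b \<epsilon> B \<and> z = pair a b)) \<and>
     (\<forall>a. a \<epsilon> A \<longrightarrow> (\<exists>!b. pair a b \<epsilon> f))"
  by (simp add: is_function_def is_pair_iff pair_in_iff)

lemma is_function_ins:
  assumes "is_function f k B" "c \<epsilon> B" shows "is_function (ins (pair k c) f) (suc k) B"
  unfolding is_function_iff
proof (intro conjI allI impI)
  fix z assume "z \<epsilon> ins (pair k c) f"
  then show "\<exists>a b. a \<epsilon> suc k \<and> b \<epsilon> B \<and> z = pair a b"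
    using assms unfolding is_function_iff by fastforce
next
  have k: "\<not> pair k b \<epsilon> f" for b using assms(1) unfolding is_function_iff by fastforce
  fix a assume "a \<epsilon> suc k"
  then show "\<exists>!b. pair a b \<epsilon> ins (pair k c) f"
    using assms(1) k unfolding is_function_iff by (cases "a = k") auto
qed

text \<open>Adjoining the pair \<open>pair k c\<close> extends a function on \<open>k\<close> to one
  on \<open>suc k\<close>; deleting that pair is the inverse.\<close>

lemma funcs_fibre:
  assumes "c \<epsilon> B"
  shows "equinumerous (funcs k B) (sep (funcs (suc k) B) (\<lambda>f. app f k = c))"
proof (rule equinumerousI)
  let ?h = "\<lambda>f. ins (pair k c) f"
  have D: "D1 (\<lambda>f. app f k = c)" by (intro definability)
  show "F1 ?h" by (intro definability)
  have k: "\<not> pair k b \<epsilon> f" if "is_function f k B" for f b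
    using that unfolding is_function_iff by fastforce
  show "bij_betw ?h (elts (funcs k B)) (elts (sep (funcs (suc k) B) (\<lambda>f. app f k = c)))"
    unfolding bij_betw_def
  proof (intro conjI inj_onI set_eqI iffI)
    fix f g assume "f \<in> elts (funcs k B)" "g \<in> elts (funcs k B)" and eq: "?h f = ?h g"
    then have "\<not> pair k c \<epsilon> f" "\<not> pair k c \<epsilon> g" using k by simp_all
    moreover have "z \<epsilon> ?h f \<longleftrightarrow> z \<epsilon> ?h g" for z using eq by simp
    ultimately show "f = g" by (intro set_ext) (metis mem_ins)
  next
    fix g assume "g \<in> ?h ` elts (funcs k B)"
    then obtain f where f: "is_function f k B" "g = ?h f" by auto
    have g: "is_function g (suc k) B" unfolding f(2) by (rule is_function_ins[OF f(1) assms])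
    have "app g k = c" using is_function_app(2)[OF g, of k c] f(2) by simp
    then show "g \<in> elts (sep (funcs (suc k) B) (\<lambda>f. app f k = c))" using g by (simp add: mem_sep[OF D])
  next
    fix g assume "g \<in> elts (sep (funcs (suc k) B) (\<lambda>f. app f k = c))"
    then have g: "is_function g (suc k) B" "app g k = c" by (simp_all add: mem_sep[OF D])
    define f where "f = diff g (upair (pair k c) (pair k c))"
    have kg: "pair k b \<epsilon> g \<longleftrightarrow> b = c" for b using is_function_app(2)[OF g(1), of k b] g(2) by simp
    have "is_function f k B" unfolding is_function_iff
    proof (intro conjI allI impI)
      fix z assume "z \<epsilon> f"
      then have z: "z \<epsilon> g" "z \<noteq> pair k c" by (simp_all add: f_def)
      then obtain a b where ab: "a \<epsilon> suc k" "b \<epsilon> B" "z = pair a b"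
        using g(1) unfolding is_function_iff by blast
      then have "a \<noteq> k" using z kg by auto
      then show "\<exists>a b. a \<epsilon> k \<and> b \<epsilon> B \<and> z = pair a b" using ab by auto
    next
      fix a assume "a \<epsilon> k"
      then have "a \<epsilon> suc k" "a \<noteq> k" by auto
      then show "\<exists>!b. pair a b \<epsilon> f" using g(1) unfolding is_function_iff f_def by auto
    qed
    moreover have "g = ?h f" by (rule set_ext) (auto simp: f_def kg)
    ultimately show "g \<in> ?h ` elts (funcs k B)" by auto
  qed
qed

text \<open>Evaluation at the last argument \<open>k\<close> splits the functions on
  \<open>suc k\<close> into \<open>p\<close> classes, each a copy of
  \<open>funcs k p\<close>.\<close>

lemma cardinal_funcs_suc:
  assumes "natural k" "natural p" "finite_set (funcs k p)"
  shows "finite_set (funcs (suc k) p) \<and> cardinal (funcs (suc k) p) = mult (cardinal (funcs k p)) p"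
proof -
  have F: "F1 (\<lambda>f. app f k)" by (intro definability)
  have D: "D1 (\<lambda>f. app f k \<epsilon> p)" by (intro definability)
  have eq: "sep (funcs (suc k) p) (\<lambda>f. app f k \<epsilon> p) = funcs (suc k) p"
    by (rule set_ext) (auto simp: mem_sep[OF D] is_function_app(1))
  have "finite_set (sep (funcs (suc k) p) (\<lambda>f. app f k \<epsilon> p)) \<and>
      cardinal (sep (funcs (suc k) p) (\<lambda>f. app f k \<epsilon> p)) = mult (cardinal (funcs k p)) (cardinal p)"
    using equinumerous_finite[OF funcs_fibre assms(3)] finite_natural[OF assms(2)] natural_cardinal[OF assms(3)]
    by (intro cardinal_fibres[OF F]) auto
  then show ?thesis unfolding eq using finite_natural(2)[OF assms(2)] by simp
qed

text \<open>The exponent may be nonstandard, so the chain property is obtained by internal induction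
  for \<open>cardinal (funcs k p)\<close>. The induction also carries that this number is nonzero
  and that its divisors other than \<open>one\<close> are multiples of \<open>p\<close>.\<close>

lemma power_chain:
  assumes p: "prime_number p" and "natural k" and n: "is_power p k n"
  shows "natural n" "n \<noteq> emp" "divisor_chain n"
proof -
  note pp = prime_numberD[OF p]
  have *: "finite_set (funcs k p) \<and> cardinal (funcs k p) \<noteq> emp \<and> divisor_chain (cardinal (funcs k p)) \<and>
      (\<forall>d. natural d \<and> divides d (cardinal (funcs k p)) \<longrightarrow> d = one \<or> divides p d)"
    using assms(2)
  proof (induction rule: natural_induct)
    case emp
    show ?case unfolding funcs_emp using finite_natural[OF natural_one] divisors_one
      by (auto simp: divisor_chain_def)
  next
    case (suc k)
    let ?n = "cardinal (funcs k p)"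
    have n: "natural ?n" using suc natural_cardinal by blast
    have "mult ?n p \<noteq> emp" using mult_eq_emp[OF n pp(1)] pp suc by blast
    then show ?case using cardinal_funcs_suc[OF suc(1) pp(1)] prime_chain_step[OF p n] suc(2) by auto
  qed (intro definability)
  have "natural n" "equinumerous (funcs k p) n" using n by (simp_all add: is_power_def is_function_space_iff)
  then have "n = cardinal (funcs k p)" using cardinal_eqI by simp
  then show "natural n" "n \<noteq> emp" "divisor_chain n" using * natural_cardinal by auto
qed

end

section \<open>Uniform choice on a well-ordered family\<close>

context ZF_model
begin

text \<open>Subsets of the disjoint union are sets of pairs whose first component names the family
  member; a fibre still consists of such pairs.\<close>

definition fibre :: "'a \<Rightarrow> 'a \<Rightarrow> 'a" where "fibre s A = sep s (\<lambda>z. fst_of z = A)"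

lemma F2_fibre: "F2 fibre" unfolding fibre_def by (intro definability)
lemmas [definability] = F2_fibre[THEN F2D]

lemma mem_fibre [simp]: "z \<epsilon> fibre s A \<longleftrightarrow> z \<epsilon> s \<and> fst_of z = A"
  unfolding fibre_def by (rule mem_sep) (intro definability)

lemma fibre_mono: "subset_of s t \<Longrightarrow> subset_of (fibre s A) (fibre t A)"
  by (simp add: subset_of_def)

lemma subset_of_trans: "subset_of a b \<Longrightarrow> subset_of b c \<Longrightarrow> subset_of a c"
  by (simp add: subset_of_def)

lemma subset_of_refl [simp]: "subset_of a a"
  by (simp add: subset_of_def)

lemma ex_mem: "a \<noteq> emp \<Longrightarrow> \<exists>z. z \<epsilon> a"
  by (auto intro: set_ext)

text \<open>\<open>D\<close> is contained in the image of \<open>s\<close> under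
  \<open>fst_of\<close>. The image is written as a union of singletons so that
  \<open>finite_set_UN\<close> applies.\<close>

lemma finite_base:
  assumes "finite_set s" "\<And>A. A \<epsilon> D \<Longrightarrow> fibre s A \<noteq> emp" shows "finite_set D"
proof -
  have G: "F1 (\<lambda>z. upair (fst_of z) (fst_of z))" by (intro definability)
  have D: "D1 (\<lambda>A. \<exists>z. z \<epsilon> s \<and> A \<epsilon> upair (fst_of z) (fst_of z))" by (intro definability)
  have f: "finite_set (upair a a)" for a
  proof -
    have "upair a a = ins a emp" by (rule set_ext) auto
    then show ?thesis by simp
  qed
  have "finite_set (sep D (\<lambda>A. \<exists>z. z \<epsilon> s \<and> A \<epsilon> upair (fst_of z) (fst_of z)))"
    by (rule finite_set_UN[OF G assms(1) f])
  moreover have "sep D (\<lambda>A. \<exists>z. z \<epsilon> s \<and> A \<epsilon> upair (fst_of z) (fst_of z)) = D"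
  proof (rule set_ext)
    fix A
    have "A \<epsilon> D \<Longrightarrow> \<exists>z. z \<epsilon> s \<and> fst_of z = A" using ex_mem[OF assms(2)] by auto
    then show "A \<epsilon> sep D (\<lambda>A. \<exists>z. z \<epsilon> s \<and> A \<epsilon> upair (fst_of z) (fst_of z)) \<longleftrightarrow> A \<epsilon> D"
      unfolding mem_sep[OF D] by auto
  qed
  ultimately show ?thesis by simp
qed

lemma finite_total:
  assumes "finite_set D" "\<And>A. A \<epsilon> D \<Longrightarrow> finite_set (fibre s A)" "\<And>z. z \<epsilon> s \<Longrightarrow> fst_of z \<epsilon> D"
  shows "finite_set s"
proof -
  have G: "F1 (\<lambda>A. fibre s A)" by (intro definability)
  have D: "D1 (\<lambda>z. \<exists>A. A \<epsilon> D \<and> z \<epsilon> fibre s A)" by (intro definability)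
  have "finite_set (sep s (\<lambda>z. \<exists>A. A \<epsilon> D \<and> z \<epsilon> fibre s A))"
    by (rule finite_set_UN[OF G assms(1,2)])
  moreover have "sep s (\<lambda>z. \<exists>A. A \<epsilon> D \<and> z \<epsilon> fibre s A) = s"
    by (rule set_ext, unfold mem_sep[OF D]) (use assms(3) in auto)
  ultimately show ?thesis by simp
qed

text \<open>The least upper bound \<open>u\<close> is attained: if \<open>u = suc v\<close>, then
  \<open>v\<close> is not an upper bound, and an \<open>e\<close> satisfying \<open>P\<close> that
  exceeds \<open>v\<close> but not \<open>u\<close> equals \<open>u\<close>.\<close>

lemma natural_greatest:
  assumes P: "D1 P" and "natural n" "natural d" "P d" "\<forall>d. natural d \<longrightarrow> P d \<longrightarrow> \<not> n \<epsilon> d"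
  obtains u where "natural u" "P u" "\<And>e. natural e \<Longrightarrow> P e \<Longrightarrow> \<not> u \<epsilon> e"
proof -
  let ?Q = "\<lambda>u. \<forall>e. natural e \<and> P e \<longrightarrow> \<not> u \<epsilon> e"
  have Q: "D1 ?Q" by (intro definability D1D[OF P])
  have "?Q n" using assms(5) by blast
  then obtain u where u: "natural u" "?Q u" "\<And>k. natural k \<Longrightarrow> ?Q k \<Longrightarrow> \<not> k \<epsilon> u"
    by (rule natural_least[OF Q assms(2)]) (rule that)
  have "P u"
  proof (rule natural_cases[OF u(1)])
    assume "u = emp"
    moreover have "\<not> u \<epsilon> d" using u(2) assms(3,4) by blast
    ultimately show "P u" using emp_mem_natural[OF assms(3)] assms(4) by auto
  next
    fix v assume v: "natural v" "u = suc v"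
    then obtain e where e: "natural e" "P e" "v \<epsilon> e" using u(3)[of v] by auto
    then have "suc v = e" using u(2) suc_mem v by blast
    then show "P u" using e v by simp
  qed
  then show ?thesis using that u by blast
qed

end

section \<open>Families of order type omega\<close>

locale omega_family = ZF_model +
  fixes F r n :: 'a
  assumes wo: "well_orders r F" and infinite: "\<not> finite_set F"
    and initial: "\<And>A. A \<epsilon> F \<Longrightarrow> finite_set (sep F (\<lambda>B. pair B A \<epsilon> r))"
    and members: "\<And>A. A \<epsilon> F \<Longrightarrow> finite_gt n A"
    and natural_n: "natural n" and n_neq_emp: "n \<noteq> emp"
begin

lemma wo_trans: "a \<epsilon> F \<Longrightarrow> b \<epsilon> F \<Longrightarrow> c \<epsilon> F \<Longrightarrow> pair a b \<epsilon> r \<Longrightarrow> pair b c \<epsilon> r \<Longrightarrow> pair a c \<epsilon> r"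
  and order_irrefl: "a \<epsilon> F \<Longrightarrow> \<not> pair a a \<epsilon> r"
  and order_total: "a \<epsilon> F \<Longrightarrow> b \<epsilon> F \<Longrightarrow> a = b \<or> pair a b \<epsilon> r \<or> pair b a \<epsilon> r"
  using wo unfolding well_orders_def pair_in_iff by blast+

definition least_of :: "'a \<Rightarrow> 'a" where
  "least_of s = descr (\<lambda>a. a \<epsilon> s \<and> (\<forall>b. b \<epsilon> s \<longrightarrow> b = a \<or> pair a b \<epsilon> r))"

lemma F1_least_of: "F1 least_of" unfolding least_of_def by (intro definability)
lemmas [definability] = F1_least_of[THEN F1D]

lemma least_of_mem:
  assumes "subset_of s F" "s \<noteq> emp" shows "least_of s \<epsilon> s"
proof -
  obtain a where a: "a \<epsilon> s" "\<forall>b. b \<epsilon> s \<longrightarrow> b = a \<or> pair a b \<epsilon> r"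
    using wo assms unfolding well_orders_def pair_in_iff is_empty_iff by blast
  have "least_of s = a" unfolding least_of_def
  proof (rule descr_eq)
    fix x assume x: "x \<epsilon> s \<and> (\<forall>b. b \<epsilon> s \<longrightarrow> b = x \<or> pair x b \<epsilon> r)"
    then have "x \<epsilon> F" "a \<epsilon> F" using a assms(1) by (auto simp: subset_of_def)
    then show "x = a" using x a wo_trans[of a x a] order_irrefl[of a] by blast
  qed (use a in blast)
  then show ?thesis using a by simp
qed

definition interval :: "'a \<Rightarrow> 'a \<Rightarrow> 'a \<Rightarrow> 'a" where
  "interval D i b = sep D (\<lambda>c. (c = i \<or> pair i c \<epsilon> r) \<and> (c = b \<or> pair c b \<epsilon> r))"

lemma F3_interval: "F3 interval" unfolding interval_def by (intro definability)
lemmas [definability] = F3_interval[THEN F3D]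

lemma mem_interval [simp]:
  "c \<epsilon> interval D i b \<longleftrightarrow> c \<epsilon> D \<and> (c = i \<or> pair i c \<epsilon> r) \<and> (c = b \<or> pair c b \<epsilon> r)"
  unfolding interval_def by (rule mem_sep) (intro definability)

lemma mem_below [simp]: "B \<epsilon> sep F (\<lambda>B. pair B A \<epsilon> r) \<longleftrightarrow> B \<epsilon> F \<and> pair B A \<epsilon> r"
  by (rule mem_sep) (intro definability)

lemma finite_interval:
  assumes "subset_of D F" "b \<epsilon> F" shows "finite_set (interval D i b)"
  by (rule finite_set_subset[OF finite_ins[OF initial[OF assms(2)]]])
    (use assms(1) in \<open>auto simp: subset_of_def\<close>)

text \<open>\<open>D\<close> is infinite, while the part below \<open>i\<close> and the interval
  found so far are finite. Hence some \<open>c\<close> lies beyond the endpoint \<open>b\<close>,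
  and moving the endpoint to \<open>c\<close> enlarges the interval.\<close>

lemma large_interval:
  assumes D: "subset_of D F" "\<not> finite_set D" and i: "i \<epsilon> D" and "natural m"
  shows "\<exists>b. b \<epsilon> D \<and> (b = i \<or> pair i b \<epsilon> r) \<and> m \<epsilon> cardinal (interval D i b)"
  using assms(4)
proof (induction rule: natural_induct)
  case emp
  have "finite_set (interval D i i)" using finite_interval D i by (auto simp: subset_of_def)
  moreover have "i \<epsilon> interval D i i" using i by simp
  then have "interval D i i \<noteq> emp" by force
  ultimately have "emp \<epsilon> cardinal (interval D i i)"
    using cardinal_eq_emp emp_mem_natural natural_cardinal by blast
  then show ?case using i by blast
next
  case (suc m)
  then obtain b where b: "b \<epsilon> D" "b = i \<or> pair i b \<epsilon> r" "m \<epsilon> cardinal (interval D i b)" by blast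
  have F: "c \<epsilon> D \<Longrightarrow> c \<epsilon> F" for c using D(1) by (simp add: subset_of_def)
  let ?X = "cup (sep F (\<lambda>c. pair c i \<epsilon> r)) (interval D i b)"
  have "finite_set ?X" using finite_cup initial finite_interval D(1) F i b by blast
  then have "\<not> subset_of D ?X" using D(2) finite_set_subset by blast
  then obtain c where c: "c \<epsilon> D" "\<not> c \<epsilon> ?X" unfolding subset_of_def by blast
  then have c1: "c = i \<or> pair i c \<epsilon> r" using order_total[of c i] F i by auto
  then have bc: "pair b c \<epsilon> r" "c \<noteq> b" using c order_total[of c b] F b by auto
  have sub: "subset_of (interval D i b) (interval D i c)"
    using bc wo_trans F b(1) c(1) unfolding subset_of_def mem_interval by blast
  have ne: "interval D i b \<noteq> interval D i c"
  proof
    assume "interval D i b = interval D i c"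
    moreover have "c \<epsilon> interval D i c" using c c1 by simp
    ultimately have "c \<epsilon> interval D i b" by simp
    then show False using c by simp
  qed
  have fin: "finite_set (interval D i c)" using finite_interval D F c by blast
  then have "cardinal (interval D i b) \<epsilon> cardinal (interval D i c)" using finite_subset_cardinal sub ne by blast
  moreover have "suc m \<epsilon> cardinal (interval D i b) \<or> suc m = cardinal (interval D i b)"
    using suc_mem b(3) finite_interval D F b natural_cardinal by blast
  ultimately have "suc m \<epsilon> cardinal (interval D i c)" 
    using natural_trans[OF natural_cardinal[OF fin], of "cardinal (interval D i b)" "suc m"] by auto
  then show ?case using c c1 by blast
qed (intro definability)

text \<open>An interval from \<open>i\<close> onwards with more than \<open>n\<close> members;
  taking the least possible endpoint makes it definable from \<open>i\<close>. Since it starts at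
  \<open>i\<close>, a finite set can meet the blocks of only finitely many \<open>i\<close>.\<close>

definition block :: "'a \<Rightarrow> 'a \<Rightarrow> 'a" where
  "block D i = interval D i (least_of (sep D (\<lambda>b. (b = i \<or> pair i b \<epsilon> r) \<and> n \<epsilon> cardinal (interval D i b))))"

lemma F2_block: "F2 block" unfolding block_def by (intro definability)
lemmas [definability] = F2_block[THEN F2D]

lemma block:
  assumes "subset_of D F" "\<not> finite_set D" "i \<epsilon> D"
  shows "finite_set (block D i)" "n \<epsilon> cardinal (block D i)"
    "\<And>j. j \<epsilon> block D i \<Longrightarrow> j \<epsilon> D \<and> (j = i \<or> pair i j \<epsilon> r)"
proof -
  let ?P = "\<lambda>b. (b = i \<or> pair i b \<epsilon> r) \<and> n \<epsilon> cardinal (interval D i b)"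
  have P: "D1 ?P" by (intro definability)
  obtain b where "b \<epsilon> sep D ?P"
    using large_interval[OF assms natural_n] unfolding mem_sep[OF P] by blast
  then have "sep D ?P \<noteq> emp" by force
  moreover have "subset_of (sep D ?P) F" using assms(1) by (simp add: subset_of_def mem_sep[OF P])
  ultimately have "least_of (sep D ?P) \<epsilon> sep D ?P" by (intro least_of_mem)
  then have *: "least_of (sep D ?P) \<epsilon> D" "n \<epsilon> cardinal (block D i)"
    unfolding mem_sep[OF P] block_def by blast+
  then show "n \<epsilon> cardinal (block D i)" by blast
  have "least_of (sep D ?P) \<epsilon> F" using *(1) assms(1) by (simp add: subset_of_def)
  then show "finite_set (block D i)" unfolding block_def by (rule finite_interval[OF assms(1)])
  show "\<And>j. j \<epsilon> block D i \<Longrightarrow> j \<epsilon> D \<and> (j = i \<or> pair i j \<epsilon> r)"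
    unfolding block_def by simp
qed

definition uniform :: "'a \<Rightarrow> 'a \<Rightarrow> 'a \<Rightarrow> bool" where
  "uniform D s m \<longleftrightarrow> subset_of D F \<and> \<not> finite_set D \<and>
     (\<forall>A. A \<epsilon> D \<longrightarrow> finite_set (fibre s A) \<and> cardinal (fibre s A) = m)"

lemma D3_uniform: "D3 uniform" unfolding uniform_def by (intro definability)
lemmas [definability] = D3_uniform[THEN D3D]

text \<open>The set \<open>rs i\<close> is the union of the fibres over \<open>block D i\<close>. If
  \<open>c (rs i)\<close> contained or missed each of these fibres entirely, \<open>n\<close> would
  be a multiple of \<open>m\<close>. So some fibre over a \<open>j\<close> in the block is cut
  properly, and these cuts are assembled into \<open>s'\<close>.\<close>

lemma split_fibres:
  assumes u: "uniform D s m" and m: "natural m" "m \<noteq> emp" "\<not> divides m n"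
    and c: "F1 c" "\<And>z. subset_of z s \<Longrightarrow> finite_gt n z \<Longrightarrow> subset_of (c z) z \<and> finite_set (c z) \<and> cardinal (c z) = n"
  obtains D' s' where "subset_of D' D" "\<not> finite_set D'" "subset_of s' s"
    "\<And>A. A \<epsilon> D' \<Longrightarrow> fibre s' A \<noteq> emp \<and> fibre s' A \<noteq> fibre s A"
proof -
  note [definability] = F1D[OF c(1)]
  have D: "subset_of D F" "\<not> finite_set D"
    and fib: "\<And>A. A \<epsilon> D \<Longrightarrow> finite_set (fibre s A) \<and> cardinal (fibre s A) = m"
    using u unfolding uniform_def by blast+
  have DF: "A \<epsilon> D \<Longrightarrow> A \<epsilon> F" for A using D(1) by (simp add: subset_of_def)
  define rs where "rs i = sep s (\<lambda>z. fst_of z \<epsilon> block D i)" for i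
  have mem_rs: "z \<epsilon> rs i \<longleftrightarrow> z \<epsilon> s \<and> fst_of z \<epsilon> block D i" for z i
    unfolding rs_def by (rule mem_sep) (intro definability)
  have "F1 rs" unfolding rs_def by (intro definability)
  note [definability] = F1D[OF this]
  have rs_sub: "subset_of (rs i) s" for i by (simp add: subset_of_def mem_rs)
  have rs_gt: "finite_gt n (rs i)" if i: "i \<epsilon> D" for i
  proof -
    note b = block[OF D i]
    have cr: "finite_set (rs i) \<and> cardinal (rs i) = mult m (cardinal (block D i))"
      unfolding rs_def
      by (rule cardinal_fibres[OF F1_fst_of b(1) m(1)]) (use fib b(3) in \<open>auto simp: fibre_def\<close>)
    have nb: "natural (cardinal (block D i))" by (rule natural_cardinal[OF b(1)])
    have "cardinal (block D i) \<noteq> emp" using b(2) by auto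
    then have "mult m (cardinal (block D i)) \<noteq> emp" using mult_eq_emp[OF m(1) nb] m(2) by blast
    \<comment> \<open>The block size divides the size of the union and hence does not exceed it,
      which passes the bound \<open>n\<close> from the block to \<open>rs i\<close>.\<close>
    moreover have "divides (cardinal (block D i)) (mult m (cardinal (block D i)))"
      unfolding mult_commute[OF m(1) nb] by (rule dividesI[OF m(1)])
    ultimately have "cardinal (block D i) = mult m (cardinal (block D i)) \<or> cardinal (block D i) \<epsilon> mult m (cardinal (block D i))"
      by (intro divides_le nb)
    then have "n \<epsilon> mult m (cardinal (block D i))"
      using b(2) natural_trans[OF natural_mult[OF m(1) nb]] by metis
    then show ?thesis using cr by (simp add: finite_gt_iff)
  qed
  have crs: "subset_of (c (rs i)) (rs i)" "finite_set (c (rs i))" "cardinal (c (rs i)) = n" if "i \<epsilon> D" for i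
    using c(2)[OF rs_sub rs_gt[OF that]] by blast+
  define Q where "Q i j \<longleftrightarrow> j \<epsilon> block D i \<and> fibre (c (rs i)) j \<noteq> emp \<and> fibre (c (rs i)) j \<noteq> fibre s j" for i j
  have "D2 Q" unfolding Q_def by (intro definability)
  note [definability] = D2D[OF this]
  have exQ: "\<exists>j. Q i j" if i: "i \<epsilon> D" for i
  proof (rule ccontr)
    assume no: "\<nexists>j. Q i j"
    note b = block[OF D i]
    \<comment> \<open>\<open>E\<close> collects the indices whose fibre is met; under the contrary
      assumption each such fibre lies entirely in the choice, which makes all of them equally
      large.\<close>
    define E where "E = sep (block D i) (\<lambda>j. fibre (c (rs i)) j \<noteq> emp)"
    have mem_E: "j \<epsilon> E \<longleftrightarrow> j \<epsilon> block D i \<and> fibre (c (rs i)) j \<noteq> emp" for j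
      unfolding E_def by (rule mem_sep) (intro definability)
    have finE: "finite_set E" by (rule finite_set_subset[OF b(1)]) (simp add: subset_of_def mem_E)
    have D1E: "D1 (\<lambda>z. fst_of z \<epsilon> E)" by (intro definability)
    have eq: "fibre (c (rs i)) j = fibre s j" "j \<epsilon> D" if "j \<epsilon> E" for j
      using no that b(3) unfolding Q_def mem_E by blast+
    have "finite_set (sep (c (rs i)) (\<lambda>z. fst_of z \<epsilon> E)) \<and>
        cardinal (sep (c (rs i)) (\<lambda>z. fst_of z \<epsilon> E)) = mult m (cardinal E)"
      by (rule cardinal_fibres[OF F1_fst_of finE m(1)]) (simp only: fibre_def[symmetric] eq(1) fib eq(2))
    moreover have "sep (c (rs i)) (\<lambda>z. fst_of z \<epsilon> E) = c (rs i)"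
    proof (rule set_ext)
      fix z
      have "fst_of z \<epsilon> E" if z: "z \<epsilon> c (rs i)"
      proof -
        have "z \<epsilon> fibre (c (rs i)) (fst_of z)" using z by simp
        then have "fibre (c (rs i)) (fst_of z) \<noteq> emp" by (metis not_mem_emp)
        moreover have "z \<epsilon> rs i" using crs(1)[OF i] z by (simp add: subset_of_def)
        ultimately show ?thesis by (simp add: mem_E mem_rs)
      qed
      then show "z \<epsilon> sep (c (rs i)) (\<lambda>z. fst_of z \<epsilon> E) \<longleftrightarrow> z \<epsilon> c (rs i)"
        unfolding mem_sep[OF D1E] by blast
    qed
    ultimately have "n = mult m (cardinal E)" using crs(3)[OF i] by simp
    then show False using m(3) dividesI[OF natural_cardinal[OF finE]] by simp
  qed
  define D' where "D' = sep D (\<lambda>j. \<exists>i. i \<epsilon> D \<and> Q i j)"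
  have mem_D': "j \<epsilon> D' \<longleftrightarrow> j \<epsilon> D \<and> (\<exists>i. i \<epsilon> D \<and> Q i j)" for j
    unfolding D'_def by (rule mem_sep) (intro definability)
  \<comment> \<open>Each \<open>i\<close> in \<open>D\<close> lies below some \<open>j\<close> in \<open>D'\<close>, and initial segments are finite.\<close>
  have infD': "\<not> finite_set D'"
  proof
    assume fin: "finite_set D'"
    let ?g = "\<lambda>j. ins j (sep F (\<lambda>i. pair i j \<epsilon> r))"
    have g: "F1 ?g" by (intro definability)
    have P: "D1 (\<lambda>z. \<exists>j. j \<epsilon> D' \<and> z \<epsilon> ?g j)" by (intro definability)
    have "finite_set (sep D (\<lambda>z. \<exists>j. j \<epsilon> D' \<and> z \<epsilon> ?g j))"
      by (rule finite_set_UN[OF g fin]) (use initial DF mem_D' in auto)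
    moreover have "sep D (\<lambda>z. \<exists>j. j \<epsilon> D' \<and> z \<epsilon> ?g j) = D"
    proof (rule set_ext)
      fix i
      have "\<exists>j. j \<epsilon> D' \<and> i \<epsilon> ?g j" if i: "i \<epsilon> D"
      proof -
        obtain j where j: "Q i j" using exQ i by blast
        then have "j \<epsilon> D" "j = i \<or> pair i j \<epsilon> r" using block(3)[OF D i] unfolding Q_def by blast+
        then show ?thesis using j i DF[OF i] mem_D' by (intro exI[of _ j]) auto
      qed
      then show "i \<epsilon> sep D (\<lambda>z. \<exists>j. j \<epsilon> D' \<and> z \<epsilon> ?g j) \<longleftrightarrow> i \<epsilon> D"
        unfolding mem_sep[OF P] by blast
    qed
    ultimately show False using D(2) by simp
  qed
  \<comment> \<open>Several \<open>i\<close> may cut the fibre over the same \<open>j\<close>; the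
    least one in the well-ordering fixes which cut is used.\<close>
  define idx where "idx j = least_of (sep D (\<lambda>i. Q i j))" for j
  have "F1 idx" unfolding idx_def by (intro definability)
  note [definability] = F1D[OF this]
  have idx: "idx j \<epsilon> D" "Q (idx j) j" if j: "j \<epsilon> D'" for j
  proof -
    have P: "D1 (\<lambda>i. Q i j)" by (intro definability)
    obtain i where "i \<epsilon> sep D (\<lambda>i. Q i j)" using j unfolding mem_D' mem_sep[OF P] by blast
    then have "sep D (\<lambda>i. Q i j) \<noteq> emp" by force
    moreover have "subset_of (sep D (\<lambda>i. Q i j)) F" using DF by (simp add: subset_of_def mem_sep[OF P])
    ultimately have "idx j \<epsilon> sep D (\<lambda>i. Q i j)" unfolding idx_def by (intro least_of_mem)
    then show "idx j \<epsilon> D" "Q (idx j) j" unfolding mem_sep[OF P] by blast+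
  qed
  define s' where "s' = sep s (\<lambda>z. z \<epsilon> c (rs (idx (fst_of z))))"
  have mem_s': "z \<epsilon> s' \<longleftrightarrow> z \<epsilon> s \<and> z \<epsilon> c (rs (idx (fst_of z)))" for z
    unfolding s'_def by (rule mem_sep) (intro definability)
  have "fibre s' j = fibre (c (rs (idx j))) j" if "j \<epsilon> D'" for j
  proof (rule set_ext)
    fix z show "z \<epsilon> fibre s' j \<longleftrightarrow> z \<epsilon> fibre (c (rs (idx j))) j"
      using crs(1)[OF idx(1)[OF that]] rs_sub[of "idx j"] by (auto simp: mem_s' subset_of_def)
  qed
  then show ?thesis using that[of D' s'] infD' idx(2) unfolding Q_def
    by (simp add: subset_of_def mem_D' mem_s')
qed

text \<open>There are only finitely many sizes below \<open>M\<close>, so one recurs on an infinite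
  subfamily; nonempty fibres exclude the size zero.\<close>

lemma uniform_size:
  assumes "subset_of D F" "\<not> finite_set D" "natural M"
    and "\<And>A. A \<epsilon> D \<Longrightarrow> finite_set (fibre s A) \<and> fibre s A \<noteq> emp \<and> cardinal (fibre s A) \<epsilon> M"
  obtains D' m where "subset_of D' D" "natural m" "m \<noteq> emp" "m \<epsilon> M" "uniform D' s m"
proof -
  have h: "F1 (\<lambda>A. cardinal (fibre s A))" by (intro definability)
  obtain m where m: "m \<epsilon> M" "\<not> finite_set (sep D (\<lambda>A. cardinal (fibre s A) = m))"
    using pigeonhole[OF h assms(2) finite_natural(1)[OF assms(3)]] assms(4) by blast
  define D' where "D' = sep D (\<lambda>A. cardinal (fibre s A) = m)"
  have mem_D': "A \<epsilon> D' \<longleftrightarrow> A \<epsilon> D \<and> cardinal (fibre s A) = m" for A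
    unfolding D'_def by (rule mem_sep) (intro definability)
  have "D' \<noteq> emp" using m(2) by (auto simp: D'_def)
  then obtain A where "A \<epsilon> D" "cardinal (fibre s A) = m" using ex_mem mem_D' by blast
  then have "m \<noteq> emp" using cardinal_eq_emp assms(4) by blast
  moreover have "uniform D' s m"
    using assms(1,4) m(2) unfolding uniform_def subset_of_def mem_D' D'_def[symmetric] by blast
  ultimately show ?thesis using that[of D' m] m(1) natural_mem[OF assms(3) m(1)]
    by (simp add: subset_of_def mem_D')
qed

text \<open>Passing to fibres makes the members of the family disjoint.\<close>
definition total :: 'a where "total = sep (product F (Union_of F)) (\<lambda>z. snd_of z \<epsilon> fst_of z)"

lemma mem_total: "z \<epsilon> total \<longleftrightarrow> (\<exists>A a. A \<epsilon> F \<and> a \<epsilon> A \<and> z = pair A a)"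
  unfolding total_def by (subst mem_sep) (intro definability, auto simp: mem_product)

lemma fibre_total:
  assumes "A \<epsilon> F" shows "finite_set (fibre total A)" "n \<epsilon> cardinal (fibre total A)"
proof -
  have "equinumerous A (fibre total A)"
  proof (rule equinumerousI)
    show "F1 (\<lambda>a. pair A a)" by (intro definability)
    show "bij_betw (\<lambda>a. pair A a) (elts A) (elts (fibre total A))"
      using assms by (auto simp: bij_betw_def inj_on_def mem_total)
  qed
  then show "finite_set (fibre total A)" "n \<epsilon> cardinal (fibre total A)"
    using members[OF assms] equinumerous_finite unfolding finite_gt_iff by auto
qed

lemma finite_fibre: "subset_of s total \<Longrightarrow> A \<epsilon> F \<Longrightarrow> finite_set (fibre s A)"
  using fibre_total(1) finite_set_subset fibre_mono by blast

text \<open>One choice function acts on all finite subsets of \<open>y\<close> with more than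
  \<open>n\<close> elements, so the minimal size \<open>m\<close> may be taken over all subsets of
  \<open>y\<close> and all infinite subfamilies of \<open>D\<close>. If \<open>m\<close> failed to
  divide \<open>n\<close>, \<open>split_fibres\<close> would give nonempty proper pieces, and
  \<open>uniform_size\<close> would stabilise their sizes below \<open>m\<close>.\<close>

lemma divisor_choice:
  assumes RC: "RC_fin n" and s: "subset_of s total"
    and D: "subset_of D F" "\<not> finite_set D" "\<And>A. A \<epsilon> D \<Longrightarrow> fibre s A \<noteq> emp"
  obtains D' s' d where "subset_of D' D" "subset_of s' s" "natural d" "d \<noteq> emp" "divides d n" "uniform D' s' d"
proof -
  \<comment> \<open>Restricting to members of \<open>D\<close> confines the infinite set returned by
    Ramsey choice to fibres over \<open>D\<close>.\<close>
  define t where "t = sep s (\<lambda>z. fst_of z \<epsilon> D)"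
  have mem_t: "z \<epsilon> t \<longleftrightarrow> z \<epsilon> s \<and> fst_of z \<epsilon> D" for z
    unfolding t_def by (rule mem_sep) (intro definability)
  have "fibre t A = fibre s A" if "A \<epsilon> D" for A by (rule set_ext) (use that in \<open>auto simp: mem_t\<close>)
  then have "\<not> finite_set t" using finite_base[of t D] D by auto
  then obtain y f Dd C where y: "subset_of y t" "\<not> finite_set y"
    and f: "is_subsets_gt y n Dd" "is_subsets_eq y n C" "is_function f Dd C"
      "\<forall>z w. pair_in z w f \<longrightarrow> subset_of w z"
    using RC unfolding RC_fin_def by blast
  have c: "subset_of (app f z) z \<and> finite_set (app f z) \<and> cardinal (app f z) = n"
    if "subset_of z y" "finite_gt n z" for z
  proof -
    have z: "z \<epsilon> Dd" using f(1) that by (simp add: is_subsets_gt_def)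
    have "equinumerous (app f z) n"
      using is_function_app(1)[OF f(3) z] f(2) by (simp add: is_subsets_eq_def)
    moreover have "subset_of (app f z) z"
      using is_function_app(2)[OF f(3) z, of "app f z"] f(4) by (simp add: pair_in_iff)
    ultimately show ?thesis by (simp add: equinumerous_natural_iff[OF natural_n])
  qed
  have F1c: "F1 (app f)" by (intro definability)
  have ys: "subset_of y s" using y(1) by (simp add: subset_of_def mem_t)
  have DF: "A \<epsilon> D \<Longrightarrow> A \<epsilon> F" for A using D(1) by (simp add: subset_of_def)
  have finy: "finite_set (fibre y A)" if "A \<epsilon> D" for A
    using finite_fibre[OF subset_of_trans[OF ys s] DF[OF that]] .
  let ?P = "\<lambda>m. m \<noteq> emp \<and> (\<exists>D' s'. subset_of D' D \<and> subset_of s' y \<and> uniform D' s' m)"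
  have P: "D1 ?P" by (intro definability)
  define D0 where "D0 = sep D (\<lambda>A. fibre y A \<noteq> emp)"
  have mem_D0: "A \<epsilon> D0 \<longleftrightarrow> A \<epsilon> D \<and> fibre y A \<noteq> emp" for A
    unfolding D0_def by (rule mem_sep) (intro definability)
  have D0: "\<not> finite_set D0"
  proof
    assume "finite_set D0"
    then have "finite_set y"
    proof (rule finite_total)
      fix z assume "z \<epsilon> y"
      then have "z \<epsilon> fibre y (fst_of z)" "fst_of z \<epsilon> D" using y(1) by (auto simp: subset_of_def mem_t)
      then show "fst_of z \<epsilon> D0" unfolding mem_D0 by (metis not_mem_emp)
    qed (use finy mem_D0 in blast)
    then show False using y(2) by blast
  qed
  define B where "B = sep D0 (\<lambda>A. n \<epsilon> cardinal (fibre y A))"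
  have mem_B: "A \<epsilon> B \<longleftrightarrow> A \<epsilon> D0 \<and> n \<epsilon> cardinal (fibre y A)" for A
    unfolding B_def by (rule mem_sep) (intro definability)
  \<comment> \<open>The fibres of \<open>y\<close> are finite but their sizes need not be bounded.
    If infinitely many exceed \<open>n\<close>, the choice function itself cuts them down to size
    \<open>n\<close>; otherwise pigeonhole applies to the sizes at most \<open>n\<close>.\<close>
  have "\<exists>m. natural m \<and> ?P m"
  proof (cases "finite_set B")
    case False
    define s1 where "s1 = sep y (\<lambda>z. z \<epsilon> app f (fibre y (fst_of z)))"
    have mem_s1: "z \<epsilon> s1 \<longleftrightarrow> z \<epsilon> y \<and> z \<epsilon> app f (fibre y (fst_of z))" for z
      unfolding s1_def by (rule mem_sep) (intro definability)
    have "finite_set (fibre s1 A) \<and> cardinal (fibre s1 A) = n" if "A \<epsilon> B" for A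
    proof -
      have A: "A \<epsilon> D" "n \<epsilon> cardinal (fibre y A)" using that by (simp_all add: mem_B mem_D0)
      have "finite_gt n (fibre y A)" using A finy by (simp add: finite_gt_iff)
      moreover have "subset_of (fibre y A) y" by (simp add: subset_of_def)
      ultimately have *: "subset_of (app f (fibre y A)) (fibre y A) \<and> finite_set (app f (fibre y A)) \<and> cardinal (app f (fibre y A)) = n"
        by (intro c)
      have "fibre s1 A = app f (fibre y A)"
        by (rule set_ext) (use * in \<open>auto simp: mem_s1 subset_of_def\<close>)
      then show ?thesis using * by simp
    qed
    then have "uniform B s1 n" using False DF unfolding uniform_def by (simp add: subset_of_def mem_B mem_D0)
    moreover have "subset_of B D" "subset_of s1 y" by (simp_all add: subset_of_def mem_B mem_D0 mem_s1)
    ultimately show ?thesis using natural_n n_neq_emp by blast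
  next
    case True
    have "\<not> finite_set (diff D0 B)"
    proof
      assume "finite_set (diff D0 B)"
      from finite_cup[OF this True] have "finite_set D0"
        by (rule finite_set_subset) (simp add: subset_of_def)
      then show False using D0 by blast
    qed
    moreover have "subset_of (diff D0 B) F" using DF by (simp add: subset_of_def mem_D0)
    moreover have "finite_set (fibre y A) \<and> fibre y A \<noteq> emp \<and> cardinal (fibre y A) \<epsilon> suc n" if "A \<epsilon> diff D0 B" for A
    proof -
      have A: "A \<epsilon> D" "fibre y A \<noteq> emp" "\<not> n \<epsilon> cardinal (fibre y A)" using that by (auto simp: mem_B mem_D0)
      then show ?thesis using finy natural_linear[OF natural_cardinal[OF finy[OF A(1)]] natural_n] by auto
    qed
    ultimately obtain D' m where "subset_of D' (diff D0 B)" "natural m" "m \<noteq> emp" "uniform D' y m"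
      using uniform_size[of "diff D0 B" "suc n" y] natural_n by (metis natural_suc)
    moreover from this have "subset_of D' D" by (simp add: subset_of_def mem_D0)
    ultimately show ?thesis using subset_of_refl by blast
  qed
  then obtain m0 where "natural m0" "?P m0" by blast
  then obtain m where m: "natural m" "?P m" "\<And>k. natural k \<Longrightarrow> ?P k \<Longrightarrow> \<not> k \<epsilon> m"
    by (rule natural_least[OF P]) (rule that)
  then obtain D1 s1 where 1: "subset_of D1 D" "subset_of s1 y" "uniform D1 s1 m" by blast
  show ?thesis
  proof (cases "divides m n")
    case True
    then show ?thesis using that[OF 1(1) subset_of_trans[OF 1(2) ys]] m 1 by blast
  next
    case False
    have c1: "subset_of (app f z) z \<and> finite_set (app f z) \<and> cardinal (app f z) = n"
      if "subset_of z s1" "finite_gt n z" for z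
      using c subset_of_trans[OF that(1) 1(2)] that by blast
    obtain D2 s2 where 2: "subset_of D2 D1" "\<not> finite_set D2" "subset_of s2 s1"
      "\<And>A. A \<epsilon> D2 \<Longrightarrow> fibre s2 A \<noteq> emp \<and> fibre s2 A \<noteq> fibre s1 A"
      using split_fibres[OF 1(3) m(1) _ False F1c c1] m(2) by blast
    have "finite_set (fibre s2 A) \<and> fibre s2 A \<noteq> emp \<and> cardinal (fibre s2 A) \<epsilon> m" if "A \<epsilon> D2" for A
    proof -
      have "finite_set (fibre s1 A)" "cardinal (fibre s1 A) = m"
        using 1(3) 2(1) that unfolding uniform_def subset_of_def by blast+
      then show ?thesis using finite_subset_cardinal[OF _ fibre_mono[OF 2(3), of A]] 2(4)[OF that] by blast
    qed
    moreover have D2: "subset_of D2 D" by (rule subset_of_trans[OF 2(1) 1(1)])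
    ultimately obtain D3 k where 3: "subset_of D3 D2" "natural k" "k \<noteq> emp" "k \<epsilon> m" "uniform D3 s2 k"
      using uniform_size[OF subset_of_trans[OF D2 D(1)] 2(2) m(1)] by metis
    have "subset_of D3 D" "subset_of s2 y"
      using subset_of_trans[OF 3(1) D2] subset_of_trans[OF 2(3) 1(2)] .
    then show ?thesis using m(3)[OF 3(2)] 3 by blast
  qed
qed

text \<open>The last conjunct makes the size of every further piece divide the running total \<open>t\<close>.\<close>
definition greedy :: "'a \<Rightarrow> 'a \<Rightarrow> 'a \<Rightarrow> bool" where
  "greedy t D s \<longleftrightarrow> uniform D s t \<and> subset_of s total \<and>
     (\<forall>d D' s'. natural d \<and> divides d n \<and> subset_of D' D \<and> subset_of s' (diff total s) \<and> uniform D' s' d \<longrightarrow> divides d t)"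

lemma D3_greedy: "D3 greedy" unfolding greedy_def by (intro definability)
lemmas [definability] = D3_greedy[THEN D3D]

text \<open>The largest uniform divisor \<open>d\<close> still available is added. A size
  \<open>e\<close> available afterwards was available before and does not exceed \<open>d\<close>,
  so in the divisor chain \<open>e\<close> divides \<open>d\<close>; by the old invariant it divides
  \<open>t\<close>, hence also the new total.\<close>

lemma greedy_step:
  assumes RC: "RC_fin n" and ch: "divisor_chain n" and I: "greedy t D s" and t: "natural t" "t \<epsilon> n"
  obtains t' D' s' where "natural t'" "t \<epsilon> t'" "t' = n \<or> t' \<epsilon> n" "greedy t' D' s'"
proof -
  have u: "uniform D s t" and s: "subset_of s total" using I unfolding greedy_def by simp_all
  have I3: "\<And>d D' s'. natural d \<Longrightarrow> divides d n \<Longrightarrow> subset_of D' D \<Longrightarrow> subset_of s' (diff total s) \<Longrightarrow>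
      uniform D' s' d \<Longrightarrow> divides d t"
    using I unfolding greedy_def by (elim conjE) blast
  have D: "subset_of D F" "\<not> finite_set D" "\<And>A. A \<epsilon> D \<Longrightarrow> finite_set (fibre s A) \<and> cardinal (fibre s A) = t"
    using u unfolding uniform_def by blast+
  \<comment> \<open>Every fibre of \<open>total\<close> has more than \<open>n\<close> elements, of
    which only \<open>t\<close>, fewer than \<open>n\<close>, are used up.\<close>
  have ne: "fibre (diff total s) A \<noteq> emp" if A: "A \<epsilon> D" for A
  proof
    assume e: "fibre (diff total s) A = emp"
    have "z \<epsilon> fibre total A \<Longrightarrow> z \<epsilon> fibre s A" for z
    proof (rule ccontr)
      assume "z \<epsilon> fibre total A" "\<not> z \<epsilon> fibre s A"
      then have "z \<epsilon> fibre (diff total s) A" by simp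
      then show False using e by simp
    qed
    then have "fibre total A = fibre s A" using fibre_mono[OF s, of A] unfolding subset_of_def by (intro set_ext) blast
    moreover have "A \<epsilon> F" using A D(1) by (simp add: subset_of_def)
    ultimately have "n \<epsilon> t" using fibre_total(2)[of A] D(3)[OF A] by simp
    then show False using t(2) mem_asym[of t n] by blast
  qed
  define P where
    "P d \<longleftrightarrow> divides d n \<and> (\<exists>D' s'. subset_of D' D \<and> subset_of s' (diff total s) \<and> uniform D' s' d)" for d
  have P: "D1 P" unfolding P_def by (intro definability)
  have "subset_of (diff total s) total" by (simp add: subset_of_def)
  then obtain D0 s0 d0 where 0: "subset_of D0 D" "subset_of s0 (diff total s)" "natural d0" "divides d0 n" "uniform D0 s0 d0"
    by (rule divisor_choice[OF RC _ D(1,2) ne])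
  have d0: "P d0" unfolding P_def using 0 by (intro conjI exI)
  have ub: "\<forall>d. natural d \<longrightarrow> P d \<longrightarrow> \<not> n \<epsilon> d"
  proof (intro allI impI)
    fix d assume "natural d" "P d"
    then have "d = n \<or> d \<epsilon> n" unfolding P_def by (intro divides_le n_neq_emp) blast+
    then show "\<not> n \<epsilon> d" using mem_asym[of d n] by auto
  qed
  obtain d where d: "natural d" "P d" "\<And>e. natural e \<Longrightarrow> P e \<Longrightarrow> \<not> d \<epsilon> e"
    by (rule natural_greatest[OF P natural_n 0(3) d0 ub]) (rule that)
  have dn: "divides d n" using d(2) unfolding P_def by blast
  from d(2) obtain D' s' where D': "subset_of D' D" "subset_of s' (diff total s)" "uniform D' s' d"
    unfolding P_def by blast
  have pos: "e \<noteq> emp" if "divides e n" for e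
  proof
    assume "e = emp"
    then obtain q where "natural q" "n = mult emp q" using dividesE[OF \<open>divides e n\<close>] by metis
    then show False using n_neq_emp by simp
  qed
  have definable_fun: "divides d t" by (rule I3[OF d(1) dn D'])
  \<comment> \<open>Both \<open>n\<close> and \<open>t\<close> are multiples of \<open>d\<close>,
    hence so is their positive difference \<open>suc c\<close>, and \<open>d\<close> cannot exceed
    it.\<close>
  have le: "add t d = n \<or> add t d \<epsilon> n"
  proof -
    obtain c where c: "natural c" "n = add t (suc c)" using mem_imp_add[OF natural_n t(2)] by blast
    have "divides d (suc c)" using divides_add_cancel[OF d(1), of "suc c" t] c definable_fun dn by simp
    then consider "d = suc c" | "d \<epsilon> suc c" using divides_le[OF d(1), of "suc c"] by auto
    then show ?thesis
    proof cases
      case 2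
      obtain e where "natural e" "suc c = add d (suc e)" using mem_imp_add[OF natural_suc[OF c(1)] 2] by blast
      then show ?thesis using mem_add_suc[of "add t d" e] add_assoc[of t d "suc e"] c t d(1) by simp
    qed (use c in simp)
  qed
  have "d \<noteq> emp" by (rule pos[OF dn])
  then obtain d' where "natural d'" "d = suc d'" using natural_cases[OF d(1)] by metis
  then have lt: "t \<epsilon> add t d" using mem_add_suc t by blast
  have "uniform D' (cup s s') (add t d)" unfolding uniform_def
  proof (intro conjI allI impI)
    show "subset_of D' F" "\<not> finite_set D'" using D' unfolding uniform_def by blast+
    fix A assume A: "A \<epsilon> D'"
    have 1: "finite_set (fibre s A)" "cardinal (fibre s A) = t" using D(3) A D'(1) by (auto simp: subset_of_def)
    have 2: "finite_set (fibre s' A)" "cardinal (fibre s' A) = d" using A D'(3) unfolding uniform_def by blast+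
    have eq: "fibre (cup s s') A = cup (fibre s A) (fibre s' A)" by (rule set_ext) auto
    show "finite_set (fibre (cup s s') A)" unfolding eq by (rule finite_cup[OF 1(1) 2(1)])
    have "cardinal (cup (fibre s A) (fibre s' A)) = add (cardinal (fibre s A)) (cardinal (fibre s' A))"
      by (rule cardinal_cup[OF 1(1) 2(1)]) (use D'(2) in \<open>auto simp: subset_of_def\<close>)
    then show "cardinal (fibre (cup s s') A) = add t d" unfolding eq 1(2) 2(2) .
  qed
  moreover have "subset_of (cup s s') total" using s D'(2) by (auto simp: subset_of_def)
  moreover have "divides e (add t d)"
    if e: "natural e \<and> divides e n \<and> subset_of D'' D' \<and> subset_of s'' (diff total (cup s s')) \<and> uniform D'' s'' e"
    for e D'' s''
  proof -
    have sub: "subset_of D'' D" "subset_of s'' (diff total s)"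
      using e D'(1) by (simp_all add: subset_of_def)
    have e': "natural e" "divides e n" "uniform D'' s'' e" using e by blast+
    have "\<not> d \<epsilon> e" using d(3)[OF e'(1)] e' sub unfolding P_def by blast
    moreover have "divides e d \<or> divides d e" using ch e'(1,2) d(1) dn unfolding divisor_chain_def by blast
    ultimately have "divides e d" using divides_le[OF d(1) pos[OF e'(2)]] divides_refl[OF d(1)] by blast
    moreover have "divides e t" by (rule I3[OF e'(1,2) sub e'(3)])
    ultimately show ?thesis by (intro divides_add e'(1))
  qed
  ultimately have "greedy (add t d) D' (cup s s')" unfolding greedy_def by (intro conjI allI impI)
  then show ?thesis by (rule that[OF natural_add[OF t(1) d(1)] lt le])
qed

text \<open>The induction runs over a lower bound \<open>t\<close>, not over the totals, which may
  skip values: for each \<open>t\<close> up to \<open>n\<close> some greedy total \<open>t'\<close>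
  lies between \<open>t\<close> and \<open>n\<close>, where \<open>\<not> t' \<epsilon> t\<close>
  says \<open>t \<le> t'\<close>. A total already above \<open>t\<close> is kept, and for
  \<open>t = n\<close> the total is \<open>n\<close>.\<close>

lemma uniform_choice:
  assumes RC: "RC_fin n" and ch: "divisor_chain n"
  obtains D s where "uniform D s n" "subset_of s total"
proof -
  have "t = n \<or> t \<epsilon> n \<longrightarrow> (\<exists>t' D s. natural t' \<and> (t' = n \<or> t' \<epsilon> n) \<and> \<not> t' \<epsilon> t \<and> greedy t' D s)"
    if "natural t" for t
    using that
  proof (induction rule: natural_induct)
    case emp
    have "fibre emp A = emp" for A by (rule set_ext) simp
    then have "uniform F emp emp" using infinite unfolding uniform_def by simp
    \<comment> \<open>The invariant holds at total zero because every number divides zero.\<close>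
    then have "greedy emp F emp" unfolding greedy_def by (simp add: subset_of_def)
    then show ?case using emp_mem_natural[OF natural_n] natural_emp not_mem_emp by metis
  next
    case (suc t)
    show ?case
    proof
      assume le: "suc t = n \<or> suc t \<epsilon> n"
      then have tn: "t \<epsilon> n" using natural_trans[OF natural_n, of "suc t" t] by auto
      then obtain t' D s where 1: "natural t'" "t' = n \<or> t' \<epsilon> n" "\<not> t' \<epsilon> t" "greedy t' D s" using suc by blast
      show "\<exists>t' D s. natural t' \<and> (t' = n \<or> t' \<epsilon> n) \<and> \<not> t' \<epsilon> suc t \<and> greedy t' D s"
      proof (cases "t' = t")
        case True
        then obtain u D' s' where u: "natural u" "t \<epsilon> u" "u = n \<or> u \<epsilon> n" "greedy u D' s'"
          using greedy_step[OF RC ch _ suc(1) tn] 1 by metis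
        have "\<not> u \<epsilon> suc t" using u(2) mem_asym[of t u] by auto
        then show ?thesis using u by blast
      next
        case False
        then show ?thesis using 1 by auto
      qed
    qed
  qed (intro definability)
  then obtain t D s where "t = n \<or> t \<epsilon> n" "\<not> t \<epsilon> n" "greedy t D s" using natural_n by blast
  then show ?thesis using that unfolding greedy_def by blast
qed

text \<open>The labels are dropped again: \<open>g A\<close> is the fibre over \<open>A\<close> read
  as a subset of \<open>A\<close>, and pairing with \<open>A\<close> preserves its size.\<close>

lemma WOC_conclusion:
  assumes RC: "RC_fin n" and ch: "divisor_chain n"
  shows "\<exists>G f U C. subset_of G F \<and> \<not> finite_set G \<and> is_union G U \<and> is_subsets_eq U n C \<and>
    is_function f G C \<and> (\<forall>A w. pair_in A w f \<longrightarrow> subset_of w A)"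
proof -
  obtain D s where u: "uniform D s n" and s: "subset_of s total" using uniform_choice[OF RC ch] .
  have D: "subset_of D F" "\<not> finite_set D" using u unfolding uniform_def by blast+
  define g where "g A = sep A (\<lambda>a. pair A a \<epsilon> s)" for A
  have g: "F1 g" unfolding g_def by (intro definability)
  have mem_g: "a \<epsilon> g A \<longleftrightarrow> a \<epsilon> A \<and> pair A a \<epsilon> s" for a A
    unfolding g_def by (rule mem_sep) (intro definability)
  have sub: "subset_of (g A) A" for A by (simp add: subset_of_def mem_g)
  have card: "equinumerous (g A) n" if A: "A \<epsilon> D" for A
  proof -
    have "equinumerous (g A) (fibre s A)"
    proof (rule equinumerousI)
      show "F1 (\<lambda>a. pair A a)" by (intro definability)
      show "bij_betw (\<lambda>a. pair A a) (elts (g A)) (elts (fibre s A))"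
        using s by (auto simp: bij_betw_def inj_on_def subset_of_def mem_total mem_g image_iff)
    qed
    moreover have "equinumerous (fibre s A) n"
      using u A unfolding uniform_def equinumerous_natural_iff[OF natural_n] by blast
    ultimately show ?thesis by (rule equinumerous_trans)
  qed
  define C where "C = sep (Power (Union_of D)) (\<lambda>z. equinumerous z n)"
  have mem_C: "z \<epsilon> C \<longleftrightarrow> subset_of z (Union_of D) \<and> equinumerous z n" for z
    unfolding C_def mem_Power[symmetric] by (rule mem_sep) (intro definability)
  have "g A \<epsilon> C" if "A \<epsilon> D" for A
    using card[OF that] that unfolding mem_C by (auto simp: subset_of_def mem_g)
  then have "is_function (graph_on D C g) D C" by (rule is_function_graph_on[OF g])
  moreover have "pair_in A w (graph_on D C g) \<longrightarrow> subset_of w A" for A w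
    using sub by (simp add: pair_in_iff pair_mem_graph_on[OF g])
  moreover have "is_subsets_eq (Union_of D) n C" by (simp add: is_subsets_eq_def mem_C)
  ultimately show ?thesis using D is_union_iff by blast
qed

end

section \<open>Reduction to order type omega and the theorem\<close>

context ZF_model
begin

text \<open>\<open>H\<close> consists of the members with finitely many predecessors. If it were
  finite, the least member outside it would have all its predecessors in \<open>H\<close>, hence
  only finitely many, and so would belong to \<open>H\<close>.\<close>

lemma RC_imp_WOC:
  assumes n: "natural n" "n \<noteq> emp" "divisor_chain n" and RC: "RC_fin n"
  shows "WOC_minus_fin n"
  unfolding WOC_minus_fin_def
proof (intro allI impI)
  fix F assume F: "\<not> finite_set F \<and> (\<exists>r. well_orders r F) \<and> (\<forall>A. A \<epsilon> F \<longrightarrow> finite_gt n A)"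
  then obtain r where r: "well_orders r F" by blast
  have below: "B \<epsilon> sep H (\<lambda>B. pair B A \<epsilon> r) \<longleftrightarrow> B \<epsilon> H \<and> pair B A \<epsilon> r" for A B H
    by (rule mem_sep) (intro definability)
  define H where "H = sep F (\<lambda>A. finite_set (sep F (\<lambda>B. pair B A \<epsilon> r)))"
  have mem_H: "A \<epsilon> H \<longleftrightarrow> A \<epsilon> F \<and> finite_set (sep F (\<lambda>B. pair B A \<epsilon> r))" for A
    unfolding H_def by (rule mem_sep) (intro definability)
  have HF: "subset_of H F" by (simp add: subset_of_def mem_H)
  have infinite: "\<not> finite_set H"
  proof
    assume fin: "finite_set H"
    have "\<not> subset_of F H" using F finite_set_subset[OF fin] by blast
    then have "\<not> is_empty (diff F H)" by (simp add: subset_of_def is_empty_def)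
    moreover have "subset_of (diff F H) F" by (simp add: subset_of_def)
    ultimately obtain a where a: "a \<epsilon> diff F H" "\<forall>b. b \<epsilon> diff F H \<longrightarrow> b = a \<or> pair a b \<epsilon> r"
      using r unfolding well_orders_def pair_in_iff by blast
    have "b \<epsilon> H" if "b \<epsilon> F" "pair b a \<epsilon> r" for b
    proof (rule ccontr)
      assume "\<not> b \<epsilon> H"
      then have "b = a \<or> pair a b \<epsilon> r" using a that by simp
      then have "pair a a \<epsilon> r" using r a(1) that unfolding well_orders_def pair_in_iff mem_diff by blast
      then show False using r a(1) unfolding well_orders_def pair_in_iff mem_diff by blast
    qed
    then have "subset_of (sep F (\<lambda>B. pair B a \<epsilon> r)) H" by (simp add: subset_of_def below)
    then have "a \<epsilon> H" using finite_set_subset[OF fin] a(1) by (simp add: mem_H)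
    then show False using a(1) by simp
  qed
  have wo: "well_orders r H"
    using r subset_of_trans[OF _ HF] unfolding well_orders_def mem_H by blast
  interpret omega_family mem H r n
  proof
    fix A assume A: "A \<epsilon> H"
    then show "finite_set (sep H (\<lambda>B. pair B A \<epsilon> r))"
      using finite_set_subset[of "sep F (\<lambda>B. pair B A \<epsilon> r)" "sep H (\<lambda>B. pair B A \<epsilon> r)"]
      by (simp add: mem_H below subset_of_def)
    show "finite_gt n A" using A F by (simp add: mem_H)
  qed (fact wo infinite n)+
  show "\<exists>G f U C. subset_of G F \<and> \<not> finite_set G \<and> is_union G U \<and> is_subsets_eq U n C \<and>
    is_function f G C \<and> (\<forall>A w. pair_in A w f \<longrightarrow> subset_of w A)"
    using WOC_conclusion[OF RC n(3)] subset_of_trans[OF _ HF] by meson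
qed

end

theorem theorem6p4:
  fixes mem :: "'a \<Rightarrow> 'a \<Rightarrow> bool"
  assumes "ZF_model mem"
  shows "\<forall>p k n. set_structure.prime_number mem p \<and> set_structure.natural mem k \<and>
           set_structure.is_power mem p k n \<longrightarrow>
           set_structure.RC_fin mem n \<longrightarrow> set_structure.WOC_minus_fin mem n"
proof (intro allI impI)
  interpret ZF_model mem by (fact assms)
  fix p k n
  assume "set_structure.prime_number mem p \<and> set_structure.natural mem k \<and> set_structure.is_power mem p k n"
    and RC: "set_structure.RC_fin mem n"
  then have "natural n" "n \<noteq> emp" "divisor_chain n" using power_chain by blast+
  then show "set_structure.WOC_minus_fin mem n" using RC by (rule RC_imp_WOC)
qed

end
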